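(* Let $n\geq2$, $\alpha\in(0,n)$, and $\kappa\in[0,\alpha)$. Suppose that $q>1$ and $p>1$ satisfy the inequalities $p>1+\frac1q-\frac{\alpha}{n}$ and $\alpha pq<n$. If $f$ is a function in $L^q(\mathbb{R}^n)$, then $$\|\mathcal{V}^f_{\alpha,p}\|_{L^s(\mathbb{R}^n,\mathcal{H}^{n-\kappa q}_\infty)}\le c\,\|f\|_{L^q(\mathbb{R}^n)}^{\frac1{p-1}},$$ where $s:=\frac{q(p-1)(n-\kappa q)}{n-\alpha pq}$ and $c$ is a (finite) constant independent of $f$.
   Context: $L^q(\mathbb{R}^n)$ denotes the usual Lebesgue space with respect to Lebesgue measure, and $B(x,r)$ is the open ball centred at $x$ with radius $r$. Riesz potential: $\mathcal{I}_\alpha f(x):=\int_{\mathbb{R}^n}\frac{|f(y)|}{|x-y|^{n-\alpha}}\,dy$ (note the absolute value of $f$). Havin--Maz'ya potential: $\mathcal{V}^f_{\alpha,p}(x):=\mathcal{I}_\alpha\big((\mathcal{I}_\alpha f)^{\frac1{p-1}}\big)(x)$, $x\in\mathbb{R}^n$. Hausdorff content: for $\delta\in(0,n]$ and any set $E\subset\mathbb{R}^n$, $$\mathcal{H}^\delta_\infty(E):=\inf\Big\{\sum_{i}r_i^\delta:\ E\subset\bigcup_{i}B(x_i,r_i)\Big\},$$ the infimum being over all countable (or finite) collections of balls covering $E$. Choquet integral: for $\Omega\subset\mathbb{R}^n$ and any $g:\Omega\to[-\infty,\infty]$, $$\int_\Omega|g|\,d\mathcal{H}^\delta_\infty:=\int_0^\infty\mathcal{H}^\delta_\infty(\{x\in\Omega:|g(x)|>t\})\,dt.$$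 For an exponent $s>0$ set $$\|g\|_{L^s(\Omega,\mathcal{H}^\delta_\infty)}:=\Big(\int_\Omega|g|^s\,d\mathcal{H}^\delta_\infty\Big)^{1/s}.$$ *)

theory Defs
  imports "HOL-Analysis.Analysis"
begin

text \<open>
  Potentials and Choquet integrals may be infinite, so they take values in \<^typ>\<open>ennreal\<close>.
  A function enters the Riesz potential and the Choquet integral only through its absolute
  value; the argument \<open>h\<close> below stands for that absolute value, with values in \<open>[0,\<infinity>]\<close>.
\<close>

text \<open>The power \<open>x\<^sup>a\<close> for \<open>x \<in> [0,\<infinity>]\<close>, intended for real \<open>a > 0\<close>; thus \<open>0\<^sup>a = 0\<close>, \<open>\<infinity>\<^sup>a = \<infinity>\<close>.\<close>

definition ennpowr :: "ennreal \<Rightarrow> real \<Rightarrow> ennreal"  (infixr "ennpowr" 80)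
  where "x ennpowr a = (if x = top then top else ennreal (enn2real x powr a))"

text \<open>
  The kernel at \<open>y = x\<close> involves a division by \<open>0\<close>, whose value is irrelevant as \<open>{x}\<close> is a null set.
\<close>

definition riesz_potential :: "real \<Rightarrow> ('a::euclidean_space \<Rightarrow> ennreal) \<Rightarrow> 'a \<Rightarrow> ennreal"
  where "riesz_potential \<alpha> h x =
    (\<integral>\<^sup>+ y. h y / ennreal (norm (x - y) powr (real DIM('a) - \<alpha>)) \<partial>lebesgue)"

definition havin_mazya_potential ::
    "real \<Rightarrow> real \<Rightarrow> ('a::euclidean_space \<Rightarrow> real) \<Rightarrow> 'a \<Rightarrow> ennreal"
  where "havin_mazya_potential \<alpha> p f =
    riesz_potential \<alpha> (\<lambda>x. riesz_potential \<alpha> (\<lambda>y. ennreal \<bar>f y\<bar>) x ennpowr (1 / (p - 1)))"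

text \<open>Index sets \<open>I\<close> of natural numbers cover both the finite and the countably infinite families.\<close>

definition hausdorff_content :: "real \<Rightarrow> 'a::euclidean_space set \<Rightarrow> ennreal"
  where "hausdorff_content \<delta> E =
    Inf {(\<Sum>\<^sub>\<infinity>i\<in>I. ennreal (r i powr \<delta>)) | (I :: nat set) (x :: nat \<Rightarrow> 'a) (r :: nat \<Rightarrow> real).
          (\<forall>i\<in>I. 0 < r i) \<and> E \<subseteq> (\<Union>i\<in>I. ball (x i) (r i))}"

definition choquet_integral ::
    "real \<Rightarrow> 'a::euclidean_space set \<Rightarrow> ('a \<Rightarrow> ennreal) \<Rightarrow> ennreal"
  where "choquet_integral \<delta> \<Omega> h =
    (\<integral>\<^sup>+ t\<in>{0<..}. hausdorff_content \<delta> {x \<in> \<Omega>. h x > ennreal t} \<partial>lborel)"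

definition choquet_norm ::
    "real \<Rightarrow> 'a::euclidean_space set \<Rightarrow> real \<Rightarrow> ('a \<Rightarrow> ennreal) \<Rightarrow> ennreal"
  where "choquet_norm \<delta> \<Omega> s h =
    choquet_integral \<delta> \<Omega> (\<lambda>x. h x ennpowr s) ennpowr (1 / s)"

definition Lebesgue_space :: "real \<Rightarrow> ('a::euclidean_space \<Rightarrow> real) set"
  where "Lebesgue_space q =
    {f \<in> borel_measurable lebesgue. integrable lebesgue (\<lambda>x. \<bar>f x\<bar> powr q)}"

definition Lebesgue_norm :: "real \<Rightarrow> ('a::euclidean_space \<Rightarrow> real) \<Rightarrow> real"
  where "Lebesgue_norm q f = (LINT x|lebesgue. \<bar>f x\<bar> powr q) powr (1 / q)"

end

(*
  Fix 1 < r < q and let G be the dyadic fractional maximal function of order \<kappa> r of |f|^r.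

  Strong type: for t = 2^j the set {G > t} is covered by triples of maximal dyadic cubes on which
  the normalised mass of |f|^r exceeds a multiple of t.  Truncating |f|^r on each cube at a height
  depending on t and on the side, and using that the maximal cubes containing a point shrink as t
  grows, bounds the Choquet integral of G^(q/r) with respect to the content of dimension
  n - \<kappa> q by the integral of |f|^q.

  Pointwise bound: Hedberg's argument gives I_\<alpha> f <= c G^e for functions of norm one.  A power G^\<eta>
  with (n - \<kappa> r) \<eta> < n has averages over a cube bounded by the \<eta>-th power of the maximal function
  restricted to larger cubes, and p > 1 + 1/q - \<alpha>/n is what makes this condition hold, for r
  close to q, for the exponent of (I_\<alpha> f)^(1/(p-1)).  Hedberg's argument then applies a second time
  and bounds the Havin-Maz'ya potential by the power q/(r s) of G.  The averaging step needs a
  positive order, so it is carried out for some \<kappa>' between \<kappa> and \<alpha>; the maximal function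
  of order \<kappa>' is dominated by a power of the one of order \<kappa>.
*)
theory Submission
  imports Defs
begin

section \<open>Countable sums and Hausdorff content\<close>

text \<open>Hausdorff content is not additive on disjoint sets, so integrals against it cannot be
  exchanged with Lebesgue integrals. Only coverings and monotonicity are used: the potential is
  dominated pointwise by a power of G, and the superlevel sets of G come with explicit coverings.

  The intermediate exponent r reconciles two demands. The strong type bound sums a geometric series
  with exponent q/r - 1, which rules out r = q. The averaging condition, taken at r = q, reads (n/q
  - \<alpha>) / (p - 1) < n, which is the hypothesis on p; being strict, it survives for r slightly
  below q.

  The hypothesis \<alpha> p q < n says \<alpha> p < n/q and makes the second Hedberg sum converge at
  large scales.

  Estimates are stated for functions of norm at most one and for positive real bounds A of the
  maximal function; the values 0 and infinity of the maximal function are recovered by a limit and a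
  triviality.\<close>

lemma nn_integral_count_space_le:
  fixes f :: "'a \<Rightarrow> ennreal"
  assumes "countable I" and le: "\<And>F. finite F \<Longrightarrow> F \<subseteq> I \<Longrightarrow> sum f F \<le> B"
  shows "(\<integral>\<^sup>+ i. f i \<partial>count_space I) \<le> B"
proof (cases "finite I")
  case True
  then show ?thesis using le[of I] by (simp add: nn_integral_count_space_finite)
next
  case False
  let ?g = "from_nat_into I"
  have bij: "bij_betw ?g UNIV I"
    using assms(1) False by (rule bij_betw_from_nat_into)
  have "(\<integral>\<^sup>+ i. f i \<partial>count_space I) = (\<integral>\<^sup>+ i. f (?g i) \<partial>count_space UNIV)"
    by (rule nn_integral_bij_count_space[OF bij, symmetric])
  also have "\<dots> = (\<Sum>i. f (?g i))" by (rule nn_integral_count_space_nat)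
  also have "\<dots> \<le> B"
  proof (rule suminf_le_const)
    fix N :: nat
    have "inj_on ?g {..<N}" using bij unfolding bij_betw_def by (meson inj_on_subset subset_UNIV)
    then have "(\<Sum>i<N. f (?g i)) = sum f (?g ` {..<N})" by (simp add: sum.reindex)
    also have "\<dots> \<le> B" using bij by (intro le) (auto simp: bij_betw_def)
    finally show "(\<Sum>i<N. f (?g i)) \<le> B" .
  qed simp
  finally show ?thesis .
qed

lemma sum_le_nn_integral_count_space:
  fixes f :: "'a \<Rightarrow> ennreal"
  assumes "finite F" "F \<subseteq> I"
  shows "sum f F \<le> (\<integral>\<^sup>+ i. f i \<partial>count_space I)"
proof -
  have "(\<integral>\<^sup>+ i. f i * indicator F i \<partial>count_space I) = (\<Sum>i\<in>F. f i * indicator F i)"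
    by (rule nn_integral_count_space') (use assms in auto)
  then have "sum f F = (\<integral>\<^sup>+ i. f i * indicator F i \<partial>count_space I)"
    by simp
  also have "\<dots> \<le> (\<integral>\<^sup>+ i. f i \<partial>count_space I)"
    by (intro nn_integral_mono) (auto simp: indicator_def)
  finally show ?thesis .
qed

lemma nn_integral_count_space_member_le:
  fixes f :: "'a \<Rightarrow> ennreal"
  assumes "i \<in> I"
  shows "f i \<le> (\<integral>\<^sup>+ i. f i \<partial>count_space I)"
  using sum_le_nn_integral_count_space[of "{i}" I f] assms by simp

lemma hausdorff_content_mono:
  assumes "E \<subseteq> F"
  shows "hausdorff_content \<delta> E \<le> hausdorff_content \<delta> F"
  unfolding hausdorff_content_def using assms by (intro Inf_superset_mono) blast

text \<open>Any countable index set can be recoded by natural numbers. The sum appears as an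
  integral over \<open>count_space\<close>, so that Tonelli's theorem can later exchange it with
  Lebesgue integrals.\<close>

lemma hausdorff_content_le:
  fixes x :: "'i \<Rightarrow> 'a::euclidean_space" and r :: "'i \<Rightarrow> real"
  assumes "countable J" "\<And>j. j \<in> J \<Longrightarrow> 0 < r j" "E \<subseteq> (\<Union>j\<in>J. ball (x j) (r j))"
  shows "hausdorff_content \<delta> E \<le> (\<integral>\<^sup>+ j. ennreal (r j powr \<delta>) \<partial>count_space J)"
proof -
  define t where "t = to_nat_on J"
  define g where "g = the_inv_into J t"
  have inj: "inj_on t J" unfolding t_def using assms(1) by (rule inj_on_to_nat_on)
  have gt: "g (t j) = j" if "j \<in> J" for j
    unfolding g_def using inj that by (rule the_inv_into_f_f)
  have "hausdorff_content \<delta> E \<le> (\<Sum>\<^sub>\<infinity>i\<in>t ` J. ennreal (r (g i) powr \<delta>))"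
    unfolding hausdorff_content_def
  proof (rule Inf_lower, rule CollectI, intro exI conjI)
    show "(\<Sum>\<^sub>\<infinity>i\<in>t ` J. ennreal (r (g i) powr \<delta>)) = (\<Sum>\<^sub>\<infinity>i\<in>t ` J. ennreal ((r \<circ> g) i powr \<delta>))" by simp
    show "\<forall>i\<in>t ` J. 0 < (r \<circ> g) i" using gt assms(2) by auto
    show "E \<subseteq> (\<Union>i\<in>t ` J. ball ((x \<circ> g) i) ((r \<circ> g) i))" using assms(3) gt by auto
  qed
  also have "\<dots> = (\<Sum>\<^sub>\<infinity>j\<in>J. ennreal (r j powr \<delta>))"
    unfolding infsum_reindex[OF inj] o_def by (rule infsum_cong) (simp add: gt)
  also have "\<dots> \<le> (\<integral>\<^sup>+ j. ennreal (r j powr \<delta>) \<partial>count_space J)"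
  proof (rule infsum_le_finite_sums)
    fix F assume "finite F" "F \<subseteq> J"
    then show "(\<Sum>j\<in>F. ennreal (r j powr \<delta>)) \<le> (\<integral>\<^sup>+ j. ennreal (r j powr \<delta>) \<partial>count_space J)"
      by (rule sum_le_nn_integral_count_space)
  qed (simp add: nonneg_summable_on_complete)
  finally show ?thesis .
qed

lemma two_powr_minus_less_1: "\<sigma> > 0 \<Longrightarrow> 2 powr (-\<sigma>) < (1::real)"
  using powr_less_mono[of "-\<sigma>" 0 "2::real"] by simp

section \<open>Lacunary and dyadic sums\<close>

text \<open>The largest term dominates a lacunary family: the sum of the others is bounded inductively by
  the same constant times \<open>(v / 2)\<^sup>\<sigma>\<close>.\<close>

lemma lacunary_sum_le:
  fixes v :: "'i \<Rightarrow> real"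
  assumes "finite F" "\<sigma> > 0"
    and "\<And>e. e \<in> F \<Longrightarrow> 0 < v e"
    and "\<And>e. e \<in> F \<Longrightarrow> v e \<le> T" "0 < T"
    and "\<And>e e'. e \<in> F \<Longrightarrow> e' \<in> F \<Longrightarrow> e \<noteq> e' \<Longrightarrow> 2 * v e \<le> v e' \<or> 2 * v e' \<le> v e"
  shows "(\<Sum>e\<in>F. v e powr \<sigma>) \<le> T powr \<sigma> / (1 - 2 powr (-\<sigma>))"
  using assms
proof (induction "card F" arbitrary: F T)
  case 0
  then have "F = {}" by simp
  have "2 powr (-\<sigma>) < (1::real)" using \<open>\<sigma> > 0\<close> by (rule two_powr_minus_less_1)
  then show ?case using \<open>F = {}\<close> by simp
next
  case (Suc c)
  define K :: real where "K = 1 / (1 - 2 powr (-\<sigma>))"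
  have p: "2 powr (-\<sigma>) < (1::real)" using \<open>\<sigma> > 0\<close> by (rule two_powr_minus_less_1)
  have Kpos: "K > 0" unfolding K_def using p by simp
  have ne: "F \<noteq> {}" using Suc by auto
  obtain e where e: "e \<in> F" and mx: "\<And>e'. e' \<in> F \<Longrightarrow> v e' \<le> v e"
  proof -
    have "Max (v ` F) \<in> v ` F" using ne \<open>finite F\<close> by (intro Max_in) auto
    then obtain e where "e \<in> F" "v e = Max (v ` F)" by auto
    then show ?thesis using that[of e] \<open>finite F\<close> by simp
  qed
  have ve: "v e > 0" using e Suc.prems by auto
  have "(\<Sum>e'\<in>F - {e}. v e' powr \<sigma>) \<le> (v e / 2) powr \<sigma> / (1 - 2 powr (-\<sigma>))"
  proof (rule Suc.hyps(1))
    show "c = card (F - {e})" using Suc e by simp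
    fix e' assume e': "e' \<in> F - {e}"
    then have "2 * v e \<le> v e' \<or> 2 * v e' \<le> v e" using Suc.prems(6)[of e e'] e by auto
    then show "v e' \<le> v e / 2" using mx[of e'] e' ve by auto
  qed (use Suc ve e in auto)
  also have "\<dots> = K * 2 powr (-\<sigma>) * v e powr \<sigma>"
    unfolding K_def using ve by (simp add: powr_divide powr_minus field_simps)
  finally have "(\<Sum>e'\<in>F. v e' powr \<sigma>) \<le> v e powr \<sigma> + K * 2 powr (-\<sigma>) * v e powr \<sigma>"
    using e \<open>finite F\<close> by (simp add: sum.remove[of F e])
  also have "\<dots> = K * v e powr \<sigma>"
  proof -
    have "K * (1 - 2 powr (-\<sigma>)) = 1" unfolding K_def using p \<open>\<sigma> > 0\<close> by simp
    then have "K * (1 - 2 powr (-\<sigma>)) * v e powr \<sigma> = v e powr \<sigma>" by simp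
    then show ?thesis by (simp add: algebra_simps)
  qed
  also have "\<dots> \<le> K * T powr \<sigma>"
    using Kpos ve Suc.prems(4)[OF e] \<open>\<sigma> > 0\<close> by (intro mult_left_mono powr_mono2) auto
  finally show ?case unfolding K_def by simp
qed

definition side :: "int \<Rightarrow> real" where "side k = 2 powr real_of_int k"

lemma side_pos [simp]: "side k > 0" by (simp add: side_def)

lemma side_nonneg [simp]: "side k \<ge> 0" by (simp add: side_def)

lemma side_neq_0 [simp]: "side k \<noteq> 0" by (simp add: side_def)

lemma side_add_1: "side (k + 1) = 2 * side k"
  by (simp add: side_def powr_add)

lemma side_mono: "j \<le> k \<Longrightarrow> side j \<le> side k" by (simp add: side_def)

lemma side_powr: "side k powr a = 2 powr (a * real_of_int k)"
  by (simp add: side_def powr_powr mult.commute)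

lemma sum_side_powr_le:
  assumes "finite F" "\<sigma> > 0" "0 < T" "\<And>k. k \<in> F \<Longrightarrow> side k \<le> T"
  shows "(\<Sum>k\<in>F. side k powr \<sigma>) \<le> T powr \<sigma> / (1 - 2 powr (-\<sigma>))"
proof (rule lacunary_sum_le)
  fix e e' :: int assume "e \<noteq> e'"
  then consider "e + 1 \<le> e'" | "e' + 1 \<le> e" by linarith
  then show "2 * side e \<le> side e' \<or> 2 * side e' \<le> side e"
    by cases (metis side_mono side_add_1)+
qed (use assms in auto)

lemma sum_side_powr_minus_le:
  assumes "finite F" "\<sigma> > 0" "0 < T" "\<And>k. k \<in> F \<Longrightarrow> T \<le> side k"
  shows "(\<Sum>k\<in>F. side k powr (-\<sigma>)) \<le> T powr (-\<sigma>) / (1 - 2 powr (-\<sigma>))"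
proof -
  have "(\<Sum>k\<in>F. (1 / side k) powr \<sigma>) \<le> (1 / T) powr \<sigma> / (1 - 2 powr (-\<sigma>))"
  proof (rule lacunary_sum_le)
    fix e e' :: int assume "e \<noteq> e'"
    then consider "e + 1 \<le> e'" | "e' + 1 \<le> e" by linarith
    then show "2 * (1 / side e) \<le> 1 / side e' \<or> 2 * (1 / side e') \<le> 1 / side e"
    proof cases
      case 1
      then have "2 * side e \<le> side e'" by (metis side_mono side_add_1)
      then show ?thesis by (auto simp: field_simps)
    next
      case 2
      then have "2 * side e' \<le> side e" by (metis side_mono side_add_1)
      then show ?thesis by (auto simp: field_simps)
    qed
  qed (use assms in \<open>auto simp: field_simps\<close>)
  then show ?thesis by (simp add: powr_divide powr_minus field_simps assms(3) less_imp_le)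
qed

text \<open>The scale optimisation in Hedberg's argument: \<open>X\<close> is the bound that is good
  at small scales, the negative power of the side the one that is good at large scales.\<close>

lemma dyadic_sum_min_le:
  assumes "0 < a" "a < b"
  obtains C :: real where "C > 0"
    "\<And>X. X > 0 \<Longrightarrow> (\<integral>\<^sup>+ k. ennreal (side k powr a * min X (side k powr (-b))) \<partial>count_space UNIV)
       \<le> ennreal (C * X powr (1 - a / b))"
proof
  define C where "C = 1 / (1 - 2 powr (-a)) + 1 / (1 - 2 powr (-(b-a)))"
  have "2 powr (-a) < (1::real)" "2 powr (-(b-a)) < (1::real)" using assms two_powr_minus_less_1[of a] two_powr_minus_less_1[of "b-a"] by linarith+
  then show Cpos: "C > 0" unfolding C_def by (intro add_pos_pos) auto
  fix X :: real assume X: "X > 0"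
  \<comment> \<open>At side length \<open>T\<close> the two entries of the minimum agree. Below
    \<open>T\<close> the terms grow geometrically with the scale and above \<open>T\<close> they
    decay, so each part is comparable to its value at \<open>T\<close>.\<close>
  define T where "T = X powr (- 1 / b)"
  have T: "T > 0" unfolding T_def using X by simp
  have e1: "X * T powr a = X powr (1 - a / b)"
  proof -
    have "X * T powr a = X powr 1 * X powr (- 1 / b * a)"
      unfolding T_def powr_powr using X by simp
    also have "\<dots> = X powr (1 + - 1 / b * a)" by (rule powr_add[symmetric])
    finally show ?thesis by simp
  qed
  have e2: "T powr (-(b-a)) = X powr (1 - a / b)"
  proof -
    have "- 1 / b * (-(b - a)) = 1 - a / b" using assms by (simp add: field_simps)
    then show ?thesis unfolding T_def powr_powr by simp
  qed
  show "(\<integral>\<^sup>+ k. ennreal (side k powr a * min X (side k powr (-b))) \<partial>count_space UNIV)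
       \<le> ennreal (C * X powr (1 - a / b))"
  proof (rule nn_integral_count_space_le)
    fix F :: "int set" assume F: "finite F"
    define F1 where "F1 = {k\<in>F. side k \<le> T}"
    define F2 where "F2 = F - F1"
    have fin: "finite F1" "finite F2" unfolding F1_def F2_def using F by auto
    have "(\<Sum>k\<in>F. side k powr a * min X (side k powr (-b)))
      = (\<Sum>k\<in>F1. side k powr a * min X (side k powr (-b))) + (\<Sum>k\<in>F2. side k powr a * min X (side k powr (-b)))"
      unfolding F2_def by (subst sum.subset_diff[of F1 F]) (use F in \<open>simp_all add: F1_def\<close>)
    also have "\<dots> \<le> (\<Sum>k\<in>F1. X * side k powr a) + (\<Sum>k\<in>F2. side k powr (-(b-a)))"
    proof (intro add_mono sum_mono)
      fix k
      show "side k powr a * min X (side k powr (-b)) \<le> X * side k powr a"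
        by (simp add: mult.commute mult_left_mono)
      have "side k powr a * min X (side k powr (-b)) \<le> side k powr a * side k powr (-b)"
        by (simp add: mult_left_mono)
      then show "side k powr a * min X (side k powr (-b)) \<le> side k powr (-(b-a))"
        by (simp add: powr_add[symmetric])
    qed
    also have "\<dots> \<le> X * (T powr a / (1 - 2 powr (-a))) + T powr (-(b-a)) / (1 - 2 powr (-(b-a)))"
    proof -
      have s1: "(\<Sum>k\<in>F1. side k powr a) \<le> T powr a / (1 - 2 powr (-a))"
        by (rule sum_side_powr_le) (use fin T assms in \<open>simp_all add: F1_def\<close>)
      have s2: "(\<Sum>k\<in>F2. side k powr (-(b-a))) \<le> T powr (-(b-a)) / (1 - 2 powr (-(b-a)))"
        by (rule sum_side_powr_minus_le) (use fin T assms in \<open>auto simp: F1_def F2_def\<close>)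
      have "(\<Sum>k\<in>F1. X * side k powr a) \<le> X * (T powr a / (1 - 2 powr (-a)))"
        unfolding sum_distrib_left[symmetric] by (rule mult_left_mono[OF s1]) (use X in simp)
      then show ?thesis using s2 by (rule add_mono)
    qed
    also have "\<dots> = C * X powr (1 - a / b)"
      unfolding times_divide_eq_right e1 e2 C_def by (simp add: distrib_right)
    finally have "(\<Sum>k\<in>F. side k powr a * min X (side k powr (-b))) \<le> C * X powr (1 - a / b)" .
    then show "(\<Sum>k\<in>F. ennreal (side k powr a * min X (side k powr (-b)))) \<le> ennreal (C * X powr (1 - a / b))"
      using X by (subst sum_ennreal) (auto simp: ennreal_leI)
  qed simp
qed

section \<open>Dyadic cubes and their triples\<close>

definition coord :: "int \<Rightarrow> 'a::euclidean_space \<Rightarrow> 'a \<Rightarrow> int"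
  where "coord k b x = \<lfloor>(x \<bullet> b) / side k\<rfloor>"

text \<open>The half-open dyadic cube containing \<open>x\<close>; a cube is addressed by any of its
  points.\<close>

definition dcube :: "int \<Rightarrow> 'a::euclidean_space \<Rightarrow> 'a set"
  where "dcube k x = {y. \<forall>b\<in>Basis. coord k b y = coord k b x}"

text \<open>The concentric triple of \<open>dcube k x\<close>: that cube together with its
  neighbours of the same size.\<close>

definition tcube :: "int \<Rightarrow> 'a::euclidean_space \<Rightarrow> 'a set"
  where "tcube k x = {y. \<forall>b\<in>Basis. \<bar>coord k b x - coord k b y\<bar> \<le> 1}"

lemma coord_bounds:
  "of_int (coord k b x) * side k \<le> x \<bullet> b" "x \<bullet> b < (of_int (coord k b x) + 1) * side k"
  unfolding coord_def by (simp_all add: pos_le_divide_eq[symmetric] pos_divide_less_eq[symmetric])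

text \<open>Passing to a coarser scale is integer division of the coordinates by a power of two, so
  nesting of cubes and of triples becomes a fact about \<open>div\<close>.\<close>

lemma coord_div:
  assumes "j \<le> k"
  shows "coord k b x = coord j b x div 2 ^ nat (k - j)"
proof -
  have "side k = side j * of_int (2 ^ nat (k - j))"
    using assms by (simp add: side_def powr_realpow[symmetric] powr_add[symmetric])
  then have "coord k b x = \<lfloor>(x \<bullet> b) / side j / of_int (2 ^ nat (k - j))\<rfloor>"
    unfolding coord_def by simp
  also have "\<dots> = coord j b x div 2 ^ nat (k - j)"
    unfolding coord_def by (rule floor_divide_real_eq_div) simp
  finally show ?thesis .
qed

lemma dcube_refl [simp]: "x \<in> dcube k x" by (simp add: dcube_def)

lemma dcube_eq: "y \<in> dcube k x \<Longrightarrow> dcube k y = dcube k x" by (auto simp: dcube_def)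

lemma dcube_mono: "j \<le> k \<Longrightarrow> dcube j x \<subseteq> dcube k x"
  by (auto simp: dcube_def coord_div)

lemma tcube_refl [simp]: "x \<in> tcube k x" by (simp add: tcube_def)

lemma tcube_sym: "y \<in> tcube k x \<longleftrightarrow> x \<in> tcube k y"
  by (simp add: tcube_def abs_minus_commute)

lemma abs_diff_div_le:
  fixes a b d :: int
  assumes "\<bar>a - b\<bar> \<le> 1" "0 < d"
  shows "\<bar>a div d - b div d\<bar> \<le> 1"
proof -
  have "a div d \<le> (b + 1 * d) div d" "b div d \<le> (a + 1 * d) div d"
    using assms by (intro zdiv_mono1; simp add: abs_le_iff)+
  then show ?thesis using assms(2) by (simp add: abs_le_iff)
qed

lemma tcube_mono: "j \<le> k \<Longrightarrow> tcube j x \<subseteq> tcube k x"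
  by (auto simp: tcube_def coord_div intro!: abs_diff_div_le)

text \<open>Two neighbour steps move each coordinate by at most two, and halving reduces this to at
  most one. Transitivity thus costs one generation.\<close>

lemma tcube_trans_succ:
  assumes "y \<in> tcube k z" "z \<in> tcube k x"
  shows "y \<in> tcube (k + 1) x"
proof -
  have "\<bar>coord (k + 1) b x - coord (k + 1) b y\<bar> \<le> 1" if "b \<in> Basis" for b
  proof -
    have "\<bar>coord k b z - coord k b y\<bar> \<le> 1" "\<bar>coord k b x - coord k b z\<bar> \<le> 1"
      using assms that by (auto simp: tcube_def)
    moreover have "coord (k + 1) b u = coord k b u div 2" for u
      using coord_div[of k "k + 1" b u] by simp
    ultimately show ?thesis by presburger
  qed
  then show ?thesis by (simp add: tcube_def)
qed

lemma tcube_trans: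
  assumes "y \<in> tcube j z" "z \<in> tcube k x" "j \<le> k"
  shows "y \<in> tcube (k + 1) x"
  using assms tcube_mono[of j k z] tcube_trans_succ by blast

lemma tcube_if_dcube: "y \<in> dcube k z \<Longrightarrow> z \<in> tcube k x \<Longrightarrow> y \<in> tcube k x"
  by (auto simp: dcube_def tcube_def)

text \<open>This is why triples are used: even a point near a face of its dyadic cube has a whole
  ball of radius \<open>side k\<close> inside the triple.\<close>

lemma mem_tcubeI:
  fixes x y :: "'a::euclidean_space"
  assumes "norm (x - y) < side k"
  shows "y \<in> tcube k x"
proof -
  have "\<bar>coord k b x - coord k b y\<bar> \<le> 1" if b: "b \<in> Basis" for b
  proof -
    have "\<bar>x \<bullet> b - y \<bullet> b\<bar> < side k"
      using Basis_le_norm[OF b, of "x - y"] assms by (simp add: inner_diff_left)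
    then have "\<bar>(x \<bullet> b) / side k - (y \<bullet> b) / side k\<bar> < 1"
      by (simp add: diff_divide_distrib[symmetric] abs_divide)
    then show ?thesis unfolding coord_def by linarith
  qed
  then show ?thesis by (simp add: tcube_def)
qed

lemma inner_diff_less_if_tcube:
  assumes "y \<in> tcube k x" "b \<in> Basis"
  shows "\<bar>(y - x) \<bullet> b\<bar> < 2 * side k"
proof -
  have "\<bar>coord k b x - coord k b y\<bar> \<le> 1" using assms by (auto simp: tcube_def)
  then have "\<bar>(x \<bullet> b) / side k - (y \<bullet> b) / side k\<bar> < 2" unfolding coord_def by linarith
  then have "\<bar>x \<bullet> b - y \<bullet> b\<bar> < 2 * side k"
    by (simp add: diff_divide_distrib[symmetric] abs_divide divide_less_eq)
  then show ?thesis by (simp add: inner_diff_left)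
qed

lemma tcube_subset_ball: "tcube k (x::'a::euclidean_space) \<subseteq> ball x (3 * real DIM('a) * side k)"
proof
  fix y assume y: "y \<in> tcube k x"
  have "norm (y - x) \<le> (\<Sum>b\<in>Basis. \<bar>(y - x) \<bullet> b\<bar>)" by (rule norm_le_l1)
  also have "\<dots> \<le> (\<Sum>b\<in>(Basis::'a set). 2 * side k)"
    using inner_diff_less_if_tcube[OF y] by (intro sum_mono) (simp add: less_imp_le)
  also have "\<dots> < 3 * real DIM('a) * side k" by simp
  finally show "y \<in> ball x (3 * real DIM('a) * side k)" by (simp add: dist_norm norm_minus_commute)
qed

lemma measurable_coord [measurable]: "(\<lambda>x. real_of_int (coord k b x)) \<in> borel_measurable borel"
  unfolding coord_def by measurable

text \<open>Coordinates are read as reals here, the form in which Borel measurability is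
  shown.\<close>

lemma tcube_altdef:
  "tcube k x = {y. \<forall>b\<in>Basis. \<bar>real_of_int (coord k b x) - real_of_int (coord k b y)\<bar> \<le> 1}"
proof -
  have "\<bar>a - b\<bar> \<le> 1 \<longleftrightarrow> \<bar>real_of_int a - real_of_int b\<bar> \<le> 1" for a b :: int by linarith
  then show ?thesis unfolding tcube_def by simp
qed

lemma pred_tcube [measurable]:
  "Measurable.pred (borel \<Otimes>\<^sub>M borel) (\<lambda>p. snd p \<in> tcube k (fst p :: 'a::euclidean_space))"
  unfolding tcube_altdef mem_Collect_eq by measurable

lemma sets_tcube [measurable]: "tcube k x \<in> sets borel"
  unfolding tcube_altdef by measurable

lemma sets_dcube [measurable]: "dcube k x \<in> sets borel"
proof -
  have "dcube k x = {y. \<forall>b\<in>Basis. real_of_int (coord k b y) = real_of_int (coord k b x)}"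
    by (simp add: dcube_def)
  also have "\<dots> \<in> sets borel" by measurable
  finally show ?thesis .
qed

lemma tcube_subset_cbox:
  "tcube k x \<subseteq> cbox (\<Sum>b\<in>Basis. (of_int (coord k b x - 1) * side k) *\<^sub>R b)
      (\<Sum>b\<in>Basis. (of_int (coord k b x + 2) * side k) *\<^sub>R b)"
proof
  fix y assume y: "y \<in> tcube k x"
  show "y \<in> cbox (\<Sum>b\<in>Basis. (of_int (coord k b x - 1) * side k) *\<^sub>R b)
      (\<Sum>b\<in>Basis. (of_int (coord k b x + 2) * side k) *\<^sub>R b)"
    unfolding mem_box
  proof (intro ballI conjI)
    fix b :: 'a assume b: "b \<in> Basis"
    have c: "\<bar>coord k b x - coord k b y\<bar> \<le> 1" using y b by (auto simp: tcube_def)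
    have "of_int (coord k b x - 1) * side k \<le> of_int (coord k b y) * side k"
      using c by (intro mult_right_mono) auto
    also have "\<dots> \<le> y \<bullet> b" by (rule coord_bounds)
    finally show "(\<Sum>b\<in>Basis. (of_int (coord k b x - 1) * side k) *\<^sub>R b) \<bullet> b \<le> y \<bullet> b" using b by simp
    have "y \<bullet> b \<le> (of_int (coord k b y) + 1) * side k" by (rule less_imp_le, rule coord_bounds)
    also have "\<dots> \<le> of_int (coord k b x + 2) * side k"
      using c by (intro mult_right_mono) auto
    finally show "y \<bullet> b \<le> (\<Sum>b\<in>Basis. (of_int (coord k b x + 2) * side k) *\<^sub>R b) \<bullet> b" using b by simp
  qed
qed

lemma emeasure_tcube_le:
  "emeasure lborel (tcube k (x::'a::euclidean_space)) \<le> ennreal (3 ^ DIM('a) * side k powr DIM('a))"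
proof -
  have "emeasure lborel (tcube k x) \<le> emeasure lborel (cbox (\<Sum>b\<in>Basis. (of_int (coord k b x - 1) * side k) *\<^sub>R b)
      (\<Sum>b\<in>Basis. (of_int (coord k b x + 2) * side k) *\<^sub>R b))"
    by (intro emeasure_mono tcube_subset_cbox) simp
  also have "\<dots> = ennreal (\<Prod>b\<in>(Basis::'a set). 3 * side k)"
  proof (subst emeasure_lborel_cbox)
    fix b :: 'a assume "b \<in> Basis"
    then show "(\<Sum>b\<in>Basis. (of_int (coord k b x - 1) * side k) *\<^sub>R b) \<bullet> b
      \<le> (\<Sum>b\<in>Basis. (of_int (coord k b x + 2) * side k) *\<^sub>R b) \<bullet> b" by (simp add: mult_right_mono)
  qed (intro arg_cong[where f = ennreal] prod.cong; simp add: inner_diff_left left_diff_distrib[symmetric])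
  also have "\<dots> = ennreal (3 ^ DIM('a) * side k powr DIM('a))"
    by (simp add: power_mult_distrib powr_realpow)
  finally show ?thesis .
qed

lemma emeasure_dcube_le:
  "emeasure lborel (dcube k (x::'a::euclidean_space)) \<le> ennreal (side k powr DIM('a))"
proof -
  let ?l = "\<Sum>b\<in>Basis. (of_int (coord k b x) * side k) *\<^sub>R b"
  let ?u = "\<Sum>b\<in>Basis. ((of_int (coord k b x) + 1) * side k) *\<^sub>R b"
  have "dcube k x \<subseteq> cbox ?l ?u"
  proof
    fix y assume "y \<in> dcube k x"
    then have "of_int (coord k b x) * side k \<le> y \<bullet> b \<and> y \<bullet> b \<le> (of_int (coord k b x) + 1) * side k"
      if "b \<in> Basis" for b
      using that coord_bounds[where k = k and x = y and b = b] by (simp add: dcube_def)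
    then show "y \<in> cbox ?l ?u" by (simp add: mem_box)
  qed
  then have "emeasure lborel (dcube k x) \<le> emeasure lborel (cbox ?l ?u)"
    by (intro emeasure_mono) simp_all
  also have "\<dots> = ennreal (\<Prod>b\<in>(Basis::'a set). side k)"
  proof (subst emeasure_lborel_cbox)
    fix b :: 'a assume "b \<in> Basis"
    then show "?l \<bullet> b \<le> ?u \<bullet> b" by (simp add: mult_right_mono)
  qed (intro arg_cong[where f = ennreal] prod.cong; simp add: inner_diff_left left_diff_distrib[symmetric])
  also have "\<dots> = ennreal (side k powr DIM('a))"
    by (simp add: powr_realpow)
  finally show ?thesis .
qed

lemma countable_range_dcube: "countable (range (dcube k :: 'a::euclidean_space \<Rightarrow> 'a set))"
proof -
  define cl where "cl m = {y::'a. \<forall>b\<in>Basis. coord k b y = m b}" for m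
  have "range (dcube k) \<subseteq> cl ` (Basis \<rightarrow>\<^sub>E (UNIV :: int set))"
  proof
    fix Q assume "Q \<in> range (dcube k :: 'a \<Rightarrow> _)"
    then obtain x where "Q = dcube k x" by auto
    then have "Q = cl (\<lambda>b\<in>Basis. coord k b x)" by (auto simp: cl_def dcube_def)
    then show "Q \<in> cl ` (Basis \<rightarrow>\<^sub>E UNIV)" by auto
  qed
  moreover have "countable (Basis \<rightarrow>\<^sub>E (UNIV :: int set) :: ('a \<Rightarrow> int) set)"
    by (intro countable_PiE) auto
  ultimately show ?thesis by (meson countable_image countable_subset)
qed

lemma tcube_eq_UN_dcube:
  fixes x :: "'a::euclidean_space"
  obtains Z where "finite Z" "card Z \<le> 3 ^ DIM('a)" "Z \<subseteq> tcube k x" "tcube k x = (\<Union>z\<in>Z. dcube k z)"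
proof
  define D where "D = (Basis :: 'a set) \<rightarrow>\<^sub>E {-1, 0, 1 :: int}"
  define pt where "pt d = x + (\<Sum>b\<in>Basis. (of_int (d b) * side k) *\<^sub>R b)" for d :: "'a \<Rightarrow> int"
  have cpt: "coord k b (pt d) = coord k b x + d b" if "b \<in> Basis" for b d
    using that by (simp add: coord_def pt_def inner_add_left add_divide_distrib)
  have "finite D" unfolding D_def by (intro finite_PiE) auto
  then show "finite (pt ` D)" by simp
  have "card (pt ` D) \<le> card D" by (rule card_image_le) fact
  also have "card D = 3 ^ DIM('a)" unfolding D_def by (simp add: card_PiE numeral_3_eq_3)
  finally show "card (pt ` D) \<le> 3 ^ DIM('a)" .
  show sub: "pt ` D \<subseteq> tcube k x"
    by (auto simp: tcube_def cpt D_def PiE_def Pi_def)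
  show "tcube k x = (\<Union>z\<in>pt ` D. dcube k z)"
  proof
    show "tcube k x \<subseteq> (\<Union>z\<in>pt ` D. dcube k z)"
    proof
      fix y assume y: "y \<in> tcube k x"
      define d where "d = (\<lambda>b\<in>Basis. coord k b y - coord k b x)"
      have "coord k b y - coord k b x \<in> {-1, 0, 1}" if "b \<in> Basis" for b
      proof -
        have "\<bar>coord k b x - coord k b y\<bar> \<le> 1" using y that by (simp add: tcube_def)
        then show ?thesis by auto
      qed
      then have "d \<in> D" unfolding D_def d_def by auto
      moreover have "y \<in> dcube k (pt d)" by (simp add: dcube_def cpt d_def)
      ultimately show "y \<in> (\<Union>z\<in>pt ` D. dcube k z)" by auto
    qed
    show "(\<Union>z\<in>pt ` D. dcube k z) \<subseteq> tcube k x" using sub tcube_if_dcube by blast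
  qed
qed

section \<open>The dyadic fractional maximal function\<close>

definition mass :: "('a::euclidean_space \<Rightarrow> real) \<Rightarrow> 'a set \<Rightarrow> ennreal"
  where "mass \<Phi> S = (\<integral>\<^sup>+ y. ennreal (\<Phi> y) * indicator S y \<partial>lborel)"

text \<open>The volume of a triple is comparable to the n-th power of \<open>side k\<close>, so up
  to constants this is the supremum of \<open>side k powr \<beta>\<close> times the average of
  \<open>\<Phi>\<close> over the triple.\<close>

definition frac_max :: "real \<Rightarrow> ('a::euclidean_space \<Rightarrow> real) \<Rightarrow> 'a \<Rightarrow> ennreal"
  where "frac_max \<beta> \<Phi> x = (SUP k. ennreal (side k powr (\<beta> - DIM('a))) * mass \<Phi> (tcube k x))"

lemma mass_mono: "S \<subseteq> T \<Longrightarrow> mass \<Phi> S \<le> mass \<Phi> T"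
  unfolding mass_def by (intro nn_integral_mono mult_left_mono) (auto simp: indicator_def)

lemma ennreal_scale_le_iff:
  assumes "0 < c"
  shows "ennreal c * a \<le> b \<longleftrightarrow> a \<le> ennreal (1 / c) * b"
proof -
  have cc: "ennreal c * ennreal (1 / c) = 1" using assms by (simp add: ennreal_mult[symmetric])
  show ?thesis
  proof
    assume "ennreal c * a \<le> b"
    then have "ennreal (1/c) * (ennreal c * a) \<le> ennreal (1 / c) * b" by (rule mult_left_mono) simp
    then show "a \<le> ennreal (1 / c) * b" by (simp add: mult.assoc[symmetric] mult.commute[of "ennreal (1/c)"] cc)
  next
    assume "a \<le> ennreal (1 / c) * b"
    then have "ennreal c * a \<le> ennreal c * (ennreal (1 / c) * b)" by (rule mult_left_mono) simp
    then show "ennreal c * a \<le> b" by (simp add: mult.assoc[symmetric] cc)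
  qed
qed

lemma frac_max_le_iff:
  fixes x :: "'a::euclidean_space" and \<beta> A :: real
  assumes "0 \<le> A"
  shows "frac_max \<beta> \<Phi> x \<le> ennreal A \<longleftrightarrow> (\<forall>k. mass \<Phi> (tcube k x) \<le> ennreal (A * side k powr (DIM('a) - \<beta>)))"
proof -
  have "1 / side k powr (\<beta> - DIM('a)) = side k powr (DIM('a) - \<beta>)" for k
    by (simp add: powr_minus_divide[symmetric])
  then show ?thesis unfolding frac_max_def using assms
    by (auto simp: SUP_le_iff ennreal_scale_le_iff mult.commute[of A] simp flip: ennreal_mult)
qed

lemma mass_measurable [measurable]:
  assumes [measurable]: "\<Phi> \<in> borel_measurable borel"
  shows "(\<lambda>x. mass \<Phi> (tcube k x)) \<in> borel_measurable borel"
proof -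
  have *: "indicator (tcube k x) y = (if y \<in> tcube k x then 1 else 0 :: ennreal)" for x y
    by (simp add: indicator_def)
  have [measurable]: "(\<lambda>p. ennreal (\<Phi> (snd p)) * (if snd p \<in> tcube k (fst p) then 1 else 0)) \<in> borel_measurable (borel \<Otimes>\<^sub>M lborel)"
    by measurable
  show ?thesis unfolding mass_def *
    by (rule lborel.borel_measurable_nn_integral) (simp add: split_def)
qed

lemma frac_max_measurable [measurable]:
  assumes [measurable]: "\<Phi> \<in> borel_measurable borel"
  shows "frac_max \<beta> \<Phi> \<in> borel_measurable borel"
  unfolding frac_max_def[abs_def] by measurable

text \<open>A substitute for Hoelder's inequality: integrating this bound and then optimising
  \<open>c\<close> gives the same powers, up to a constant factor.\<close>

lemma Young_add_le:
  fixes g c \<tau> :: real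
  assumes "0 < c" "0 \<le> g" "1 < \<tau>"
  shows "g \<le> c + c powr (1 - \<tau>) * g powr \<tau>"
proof (cases "g \<le> c")
  case True
  then show ?thesis by (simp add: add_increasing2)
next
  case False
  then have g: "g > c" by simp
  have "g powr (1 - \<tau>) \<le> c powr (1 - \<tau>)" using assms g by (intro powr_mono2') auto
  then have "g powr (1 - \<tau>) * g powr \<tau> \<le> c powr (1 - \<tau>) * g powr \<tau>" by (intro mult_right_mono) auto
  moreover have "g powr (1 - \<tau>) * g powr \<tau> = g" using assms g by (simp add: powr_add[symmetric])
  ultimately show ?thesis using assms(1) by simp
qed

lemma mass_tcube_le:
  fixes g :: "'a::euclidean_space \<Rightarrow> real"
  assumes [measurable]: "g \<in> borel_measurable borel" and nn: "\<And>y. 0 \<le> g y" and "1 < \<tau>" "0 < B"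
    and B: "mass (\<lambda>y. g y powr \<tau>) (tcube k x) \<le> ennreal B"
  shows "mass g (tcube k x) \<le> ennreal ((3 ^ DIM('a) + 1) * side k powr (DIM('a) - DIM('a) / \<tau>) * B powr (1 / \<tau>))"
proof -
  let ?n = "real DIM('a)" and ?S = "tcube k x"
  \<comment> \<open>With this \<open>c\<close> the terms \<open>c * side k powr ?n\<close> and
    \<open>c powr (1 - \<tau>) * B\<close> are equal; \<open>c1\<close> and \<open>c2\<close>
    compute their common value.\<close>
  define c where "c = B powr (1 / \<tau>) * side k powr (- ?n / \<tau>)"
  have c: "c > 0" unfolding c_def using \<open>0 < B\<close> by simp
  have c1: "c * side k powr ?n = side k powr (?n - ?n / \<tau>) * B powr (1 / \<tau>)"
    unfolding c_def by (simp add: powr_add[symmetric] algebra_simps)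
  have "c powr (1 - \<tau>) = B powr (1 / \<tau> * (1 - \<tau>)) * side k powr (- ?n / \<tau> * (1 - \<tau>))"
    unfolding c_def using \<open>0 < B\<close> by (simp add: powr_mult powr_powr)
  also have "\<dots> = B powr (1 / \<tau> - 1) * side k powr (?n - ?n / \<tau>)"
  proof -
    have "1 / \<tau> * (1 - \<tau>) = 1 / \<tau> - 1" "- ?n / \<tau> * (1 - \<tau>) = ?n - ?n / \<tau>"
      using \<open>1 < \<tau>\<close> by (simp_all add: field_simps)
    then show ?thesis by simp
  qed
  also have "B powr (1 / \<tau> - 1) = B powr (1 / \<tau>) / B" using \<open>0 < B\<close> by (simp add: powr_diff)
  finally have c2: "c powr (1 - \<tau>) * B = side k powr (?n - ?n / \<tau>) * B powr (1 / \<tau>)"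
    using \<open>0 < B\<close> by simp
  have "mass g ?S \<le> (\<integral>\<^sup>+ y. ennreal c * indicator ?S y + ennreal (c powr (1 - \<tau>)) * (ennreal (g y powr \<tau>) * indicator ?S y) \<partial>lborel)"
    unfolding mass_def
  proof (intro nn_integral_mono)
    fix y
    have "ennreal (g y) \<le> ennreal (c + c powr (1 - \<tau>) * g y powr \<tau>)"
      by (intro ennreal_leI Young_add_le c nn \<open>1 < \<tau>\<close>)
    then show "ennreal (g y) * indicator ?S y \<le> ennreal c * indicator ?S y + ennreal (c powr (1 - \<tau>)) * (ennreal (g y powr \<tau>) * indicator ?S y)"
      using c by (simp add: indicator_def ennreal_mult)
  qed
  also have "\<dots> = ennreal c * emeasure lborel ?S + ennreal (c powr (1 - \<tau>)) * mass (\<lambda>y. g y powr \<tau>) ?S"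
    unfolding mass_def by (subst nn_integral_add) (simp_all add: nn_integral_cmult)
  also have "\<dots> \<le> ennreal c * ennreal (3 ^ DIM('a) * side k powr ?n) + ennreal (c powr (1 - \<tau>)) * ennreal B"
    by (intro add_mono mult_left_mono emeasure_tcube_le B) auto
  also have "\<dots> = ennreal (3 ^ DIM('a) * (c * side k powr ?n) + c powr (1 - \<tau>) * B)"
    using c \<open>0 < B\<close> by (simp add: ennreal_mult[symmetric] algebra_simps flip: ennreal_plus)
  also have "3 ^ DIM('a) * (c * side k powr ?n) + c powr (1 - \<tau>) * B = (3 ^ DIM('a) + 1) * side k powr (?n - ?n / \<tau>) * B powr (1 / \<tau>)"
    unfolding c1 c2 by (simp add: algebra_simps)
  finally show ?thesis .
qed

lemma mass_tcube_le_unit: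
  fixes \<Phi> :: "'a::euclidean_space \<Rightarrow> real"
  assumes "\<Phi> \<in> borel_measurable borel" "\<And>y. 0 \<le> \<Phi> y" "1 < \<tau>"
    and "(\<integral>\<^sup>+ y. ennreal (\<Phi> y powr \<tau>) \<partial>lborel) \<le> 1"
  shows "mass \<Phi> (tcube k x) \<le> ennreal ((3 ^ DIM('a) + 1) * side k powr (DIM('a) - DIM('a) / \<tau>))"
proof -
  have "mass (\<lambda>y. \<Phi> y powr \<tau>) (tcube k x) \<le> mass (\<lambda>y. \<Phi> y powr \<tau>) UNIV" by (rule mass_mono) simp
  also have "\<dots> \<le> ennreal 1" using assms(4) by (simp add: mass_def)
  finally show ?thesis using mass_tcube_le[OF assms(1-3), of 1 k x] by simp
qed

lemma mass_UN_le:
  assumes "finite Z" "\<Phi> \<in> borel_measurable borel" "\<And>z. z \<in> Z \<Longrightarrow> S z \<in> sets borel"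
  shows "mass \<Phi> (\<Union>z\<in>Z. S z) \<le> (\<Sum>z\<in>Z. mass \<Phi> (S z))"
proof -
  have "mass \<Phi> (\<Union>z\<in>Z. S z) \<le> (\<integral>\<^sup>+ y. (\<Sum>z\<in>Z. ennreal (\<Phi> y) * indicator (S z) y) \<partial>lborel)"
    unfolding mass_def
  proof (intro nn_integral_mono)
    fix y
    show "ennreal (\<Phi> y) * indicator (\<Union>z\<in>Z. S z) y \<le> (\<Sum>z\<in>Z. ennreal (\<Phi> y) * indicator (S z) y)"
    proof (cases "\<exists>z\<in>Z. y \<in> S z")
      case True
      then obtain z where "z \<in> Z" "y \<in> S z" by auto
      then show ?thesis using member_le_sum[of z Z "\<lambda>z. ennreal (\<Phi> y) * indicator (S z) y"] assms(1)
        by (auto simp: indicator_def)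
    qed (auto simp: indicator_def)
  qed
  also have "\<dots> = (\<Sum>z\<in>Z. mass \<Phi> (S z))"
    unfolding mass_def using assms(2,3) by (intro nn_integral_sum) auto
  finally show ?thesis .
qed


section \<open>The Choquet estimate for the maximal function\<close>

text \<open>The division by \<open>3 ^ DIM('a)\<close> accounts for the pigeonhole step: if the mass
  of a triple exceeds a threshold, then one of its at most \<open>3 ^ DIM('a)\<close> cubes carries
  at least the corresponding fraction.\<close>

definition heavy :: "real \<Rightarrow> ('a::euclidean_space \<Rightarrow> real) \<Rightarrow> int \<Rightarrow> int \<Rightarrow> 'a \<Rightarrow> bool"
  where "heavy \<beta> \<Phi> j k x \<longleftrightarrow>
    ennreal (side j * side k powr (real DIM('a) - \<beta>) / 3 ^ DIM('a)) < mass \<Phi> (dcube k x)"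

text \<open>The level \<open>j\<close> is recorded with the cube, since one cube may be maximal for
  several levels and must then be counted once for each.\<close>

definition max_heavy :: "real \<Rightarrow> ('a::euclidean_space \<Rightarrow> real) \<Rightarrow> (int \<times> int \<times> 'a set) set"
  where "max_heavy \<beta> \<Phi> =
    {(j, k, Q). \<exists>x. Q = dcube k x \<and> heavy \<beta> \<Phi> j k x \<and> (\<forall>k'>k. \<not> heavy \<beta> \<Phi> j k' x)}"

lemma heavy_cong: "y \<in> dcube k x \<Longrightarrow> heavy \<beta> \<Phi> j k y \<longleftrightarrow> heavy \<beta> \<Phi> j k x"
  by (simp add: heavy_def dcube_eq)

lemma heavy_antimono: "i \<le> j \<Longrightarrow> heavy \<beta> \<Phi> j k x \<Longrightarrow> heavy \<beta> \<Phi> i k x"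
  unfolding heavy_def
  by (erule order.strict_trans1[rotated]) (intro ennreal_leI divide_right_mono mult_right_mono side_mono; simp)

lemma max_heavyD:
  assumes "(j, k, Q) \<in> max_heavy \<beta> \<Phi>" "y \<in> Q"
  shows "Q = dcube k y" "heavy \<beta> \<Phi> j k y" "\<And>k'. heavy \<beta> \<Phi> j k' y \<Longrightarrow> k' \<le> k"
proof -
  obtain x where x: "Q = dcube k x" "heavy \<beta> \<Phi> j k x" "\<forall>k'>k. \<not> heavy \<beta> \<Phi> j k' x"
    using assms(1) by (auto simp: max_heavy_def)
  then have y: "y \<in> dcube k x" using assms(2) by simp
  show "Q = dcube k y" "heavy \<beta> \<Phi> j k y" using x y by (simp_all add: dcube_eq heavy_cong)
  fix k' assume h: "heavy \<beta> \<Phi> j k' y"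
  show "k' \<le> k"
  proof (rule ccontr)
    assume "\<not> k' \<le> k"
    then have "y \<in> dcube k' x" using y dcube_mono[of k k' x] by auto
    then show False using h x(3) \<open>\<not> k' \<le> k\<close> by (simp add: heavy_cong)
  qed
qed

lemma countable_max_heavy: "countable (max_heavy \<beta> (\<Phi> :: 'a::euclidean_space \<Rightarrow> real))"
proof (rule countable_subset)
  show "max_heavy \<beta> \<Phi> \<subseteq> UNIV \<times> UNIV \<times> (\<Union>k. range (dcube k))"
    by (auto simp: max_heavy_def)
  show "countable ((UNIV :: int set) \<times> (UNIV :: int set) \<times> (\<Union>k. range (dcube k :: 'a \<Rightarrow> _)))"
    by (intro countable_SIGMA countable_UN countable_range_dcube) auto
qed

lemma exists_heavy:
  fixes x :: "'a::euclidean_space" and \<beta> :: real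
  assumes [measurable]: "\<Phi> \<in> borel_measurable borel"
    and "ennreal (side j) < frac_max \<beta> \<Phi> x"
  obtains k z where "z \<in> tcube k x" "heavy \<beta> \<Phi> j k z"
proof -
  have "\<not> (\<forall>k. mass \<Phi> (tcube k x) \<le> ennreal (side j * side k powr (real DIM('a) - \<beta>)))"
    using assms(2) by (simp add: frac_max_le_iff[symmetric] not_le)
  then obtain k where k: "ennreal (side j * side k powr (real DIM('a) - \<beta>)) < mass \<Phi> (tcube k x)"
    by (auto simp: not_le)
  obtain Z where Z: "finite Z" "card Z \<le> 3 ^ DIM('a)" "Z \<subseteq> tcube k x" "tcube k x = (\<Union>z\<in>Z. dcube k z)"
    by (rule tcube_eq_UN_dcube)
  have "\<exists>z\<in>Z. heavy \<beta> \<Phi> j k z"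
  proof (rule ccontr)
    assume *: "\<not> ?thesis"
    define c where "c = side j * side k powr (real DIM('a) - \<beta>) / 3 ^ DIM('a)"
    have c: "c \<ge> 0" by (simp add: c_def)
    have "real (card Z) \<le> real (3 ^ DIM('a))" using Z(2) by (rule of_nat_mono)
    then have cz: "real (card Z) \<le> 3 ^ DIM('a)" by simp
    have "mass \<Phi> (tcube k x) \<le> (\<Sum>z\<in>Z. mass \<Phi> (dcube k z))"
      unfolding Z(4) using Z(1) by (intro mass_UN_le) auto
    also have "\<dots> \<le> (\<Sum>z\<in>Z. ennreal c)"
      using * by (intro sum_mono) (simp add: heavy_def c_def not_less)
    also have "\<dots> = ennreal (real (card Z) * c)"
      using c by (simp add: ennreal_mult ennreal_of_nat_eq_real_of_nat)
    also have "\<dots> \<le> ennreal (3 ^ DIM('a) * c)"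
      using cz c by (intro ennreal_leI mult_right_mono)
    also have "3 ^ DIM('a) * c = side j * side k powr (real DIM('a) - \<beta>)" by (simp add: c_def)
    finally show False using k by simp
  qed
  then show ?thesis using that Z(3) by blast
qed

text \<open>At a fixed level the side of a heavy cube is bounded: by Hoelder its mass is at most a
  multiple of \<open>side k\<close> to the power n - n / \<tau>, which grows more slowly than the
  threshold because \<beta> < n / \<tau>. This is what provides maximal heavy cubes.\<close>

lemma heavy_le:
  fixes \<Phi> :: "'a::euclidean_space \<Rightarrow> real" and \<beta> \<tau> :: real
  assumes \<Phi>: "\<Phi> \<in> borel_measurable borel" "\<And>y. 0 \<le> \<Phi> y" and "1 < \<tau>" "\<beta> * \<tau> < DIM('a)"
    and int: "(\<integral>\<^sup>+ y. ennreal (\<Phi> y powr \<tau>) \<partial>lborel) \<le> 1"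
  obtains K where "\<And>k x. heavy \<beta> \<Phi> j k x \<Longrightarrow> k \<le> K"
proof -
  let ?n = "real DIM('a)"
  define e where "e = ?n / \<tau> - \<beta>"
  have e: "e > 0" unfolding e_def using assms(3,4) by (simp add: field_simps)
  define D where "D = 3 ^ DIM('a) * (3 ^ DIM('a) + 1) / side j"
  have D: "D > 0" unfolding D_def by (intro divide_pos_pos mult_pos_pos add_pos_pos) auto
  have "k \<le> \<lfloor>log 2 D / e\<rfloor>" if h: "heavy \<beta> \<Phi> j k x" for k x
  proof -
    have "ennreal (side j * side k powr (?n - \<beta>) / 3 ^ DIM('a)) < mass \<Phi> (dcube k x)"
      using h by (simp add: heavy_def)
    also have "\<dots> \<le> mass \<Phi> (tcube k x)"
      by (intro mass_mono) (auto intro: tcube_if_dcube)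
    also have "\<dots> \<le> ennreal ((3 ^ DIM('a) + 1) * side k powr (?n - ?n / \<tau>))"
      by (rule mass_tcube_le_unit[OF \<Phi> \<open>1 < \<tau>\<close> int])
    finally have "side j * side k powr (?n - \<beta>) / 3 ^ DIM('a) < (3 ^ DIM('a) + 1) * side k powr (?n - ?n / \<tau>)"
      by (subst (asm) ennreal_less_iff) auto
    also have "side k powr (?n - \<beta>) = side k powr (?n - ?n / \<tau>) * side k powr e"
      unfolding e_def by (simp add: powr_add[symmetric])
    finally have "side k powr (?n - ?n / \<tau>) * (side j * side k powr e / 3 ^ DIM('a))
        < side k powr (?n - ?n / \<tau>) * (3 ^ DIM('a) + 1)" by (simp add: mult_ac)
    then have "side j * side k powr e / 3 ^ DIM('a) < 3 ^ DIM('a) + 1"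
      by (subst (asm) mult_less_cancel_left_pos) auto
    then have "side k powr e < D"
      unfolding D_def by (simp add: field_simps)
    then have "e * real_of_int k < log 2 D"
      using D by (simp add: side_powr less_log_iff)
    then have "real_of_int k < log 2 D / e" using e by (simp add: field_simps)
    then show ?thesis by (simp add: le_floor_iff)
  qed
  then show ?thesis using that by blast
qed

lemma heavy_extend:
  assumes K: "\<forall>k x. heavy \<beta> \<Phi> j k x \<longrightarrow> k \<le> K" and h: "heavy \<beta> \<Phi> j k z"
  obtains k' where "k \<le> k'" "(j, k', dcube k' z) \<in> max_heavy \<beta> \<Phi>"
proof -
  have fin: "finite {i. k \<le> i \<and> heavy \<beta> \<Phi> j i z}"
    by (rule finite_subset[of _ "{k..K}"]) (use K in auto)
  define k' where "k' = Max {i. k \<le> i \<and> heavy \<beta> \<Phi> j i z}"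
  have "k' \<in> {i. k \<le> i \<and> heavy \<beta> \<Phi> j i z}"
    unfolding k'_def using fin h by (intro Max_in) auto
  moreover have "i \<le> k'" if "k \<le> i" "heavy \<beta> \<Phi> j i z" for i
    unfolding k'_def using fin that by (intro Max_ge) auto
  ultimately have k': "heavy \<beta> \<Phi> j k' z" "k \<le> k'" and mx: "\<And>i. k \<le> i \<Longrightarrow> heavy \<beta> \<Phi> j i z \<Longrightarrow> i \<le> k'"
    by auto
  have "\<forall>i>k'. \<not> heavy \<beta> \<Phi> j i z" by (meson mx k'(2) less_imp_le not_le order_trans)
  with k' have "(j, k', dcube k' z) \<in> max_heavy \<beta> \<Phi>" unfolding max_heavy_def by blast
  then show ?thesis using that \<open>k \<le> k'\<close> by blast
qed

text \<open>A point of the superlevel set lies in the triple of a heavy cube, hence in the triple of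
  a maximal heavy cube containing that one, and this triple fits into a ball of comparable
  radius.\<close>

lemma content_superlevel_le:
  fixes \<Phi> :: "'a::euclidean_space \<Rightarrow> real" and \<beta> \<tau> :: real
  assumes \<Phi>: "\<Phi> \<in> borel_measurable borel" "\<And>y. 0 \<le> \<Phi> y" and "1 < \<tau>" "\<beta> * \<tau> < DIM('a)"
    and int: "(\<integral>\<^sup>+ y. ennreal (\<Phi> y powr \<tau>) \<partial>lborel) \<le> 1"
  shows "hausdorff_content \<delta> {x. ennreal (side j) < frac_max \<beta> \<Phi> x}
    \<le> (\<integral>\<^sup>+ (k, Q). ennreal ((3 * DIM('a) * side k) powr \<delta>) * indicator (max_heavy \<beta> \<Phi>) (j, k, Q) \<partial>count_space UNIV)"
proof -
  obtain K where K: "\<forall>k x. heavy \<beta> \<Phi> j k x \<longrightarrow> k \<le> K"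
    using heavy_le[OF assms] by metis
  define J where "J = {(k, Q). (j, k, Q) \<in> max_heavy \<beta> \<Phi>}"
  \<comment> \<open>Any point of the cube may serve as centre of the ball, because the triple
    depends only on the cube.\<close>
  define ctr where "ctr e = (SOME z. z \<in> snd e)" for e :: "int \<times> 'a set"
  have "countable J"
  proof (rule countable_subset)
    show "J \<subseteq> snd ` max_heavy \<beta> \<Phi>" by (force simp: J_def image_iff)
  qed (intro countable_image countable_max_heavy)
  then have "hausdorff_content \<delta> {x. ennreal (side j) < frac_max \<beta> \<Phi> x}
    \<le> (\<integral>\<^sup>+ e. ennreal ((3 * DIM('a) * side (fst e)) powr \<delta>) \<partial>count_space J)"
  proof (rule hausdorff_content_le)
    show "{x. ennreal (side j) < frac_max \<beta> \<Phi> x} \<subseteq> (\<Union>e\<in>J. ball (ctr e) (3 * DIM('a) * side (fst e)))"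
    proof
      fix x assume "x \<in> {x. ennreal (side j) < frac_max \<beta> \<Phi> x}"
      then have "ennreal (side j) < frac_max \<beta> \<Phi> x" by simp
      then obtain k z where z: "z \<in> tcube k x" and h: "heavy \<beta> \<Phi> j k z"
        by (rule exists_heavy[OF \<Phi>(1)])
      obtain k' where k': "k \<le> k'" "(j, k', dcube k' z) \<in> max_heavy \<beta> \<Phi>"
        by (rule heavy_extend[OF K h])
      define e where "e = (k', dcube k' z)"
      have "e \<in> J" using k' by (simp add: J_def e_def)
      have "ctr e \<in> dcube k' z" unfolding ctr_def e_def snd_conv by (rule someI[of _ z]) simp
      moreover have "z \<in> tcube k' x" using z k'(1) tcube_mono by blast
      ultimately have "x \<in> tcube k' (ctr e)" using tcube_if_dcube tcube_sym by blast
      then have "x \<in> ball (ctr e) (3 * DIM('a) * side (fst e))"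
        using tcube_subset_ball[of k' "ctr e"] by (auto simp: e_def)
      with \<open>e \<in> J\<close> show "x \<in> (\<Union>e\<in>J. ball (ctr e) (3 * DIM('a) * side (fst e)))" by blast
    qed
  qed simp
  also have "\<dots> = (\<integral>\<^sup>+ e. ennreal ((3 * DIM('a) * side (fst e)) powr \<delta>) * indicator J e \<partial>count_space UNIV)"
    by (simp add: nn_integral_count_space_indicator)
  also have "\<dots> = (\<integral>\<^sup>+ (k, Q). ennreal ((3 * DIM('a) * side k) powr \<delta>) * indicator (max_heavy \<beta> \<Phi>) (j, k, Q) \<partial>count_space UNIV)"
    by (intro nn_integral_cong) (auto simp: J_def indicator_def)
  finally show ?thesis .
qed

text \<open>Points where \<open>\<Phi>\<close> stays below the cut carry at most the cut times the
  volume of the cube. The constant \<open>c\<close> makes this half of the mass that heaviness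
  guarantees, so the other half lies above the cut.\<close>

lemma heavy_truncate:
  fixes \<Phi> :: "'a::euclidean_space \<Rightarrow> real" and \<beta> :: real
  assumes [measurable]: "\<Phi> \<in> borel_measurable borel" and nn: "\<And>y. 0 \<le> \<Phi> y" and h: "heavy \<beta> \<Phi> j k x"
  defines "c \<equiv> 1 / (2 * 3 ^ DIM('a))"
  shows "ennreal (c * side j * side k powr (real DIM('a) - \<beta>))
    \<le> (\<integral>\<^sup>+ y. ennreal (\<Phi> y) * indicator (dcube k x \<inter> {y. c * (side j * side k powr (-\<beta>)) < \<Phi> y}) y \<partial>lborel)"
    (is "_ \<le> ?T")
proof -
  let ?n = "real DIM('a)"
  define a where "a = c * side j * side k powr (?n - \<beta>)"
  define l where "l = c * (side j * side k powr (-\<beta>))"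
  have c: "c > 0" by (simp add: c_def)
  have pos: "a \<ge> 0" "l \<ge> 0" unfolding a_def l_def using c by simp_all
  have la: "l * side k powr ?n = a" unfolding a_def l_def
    by (simp add: powr_add[symmetric] mult.assoc add.commute)
  have "ennreal (2 * a) \<le> mass \<Phi> (dcube k x)"
    using h unfolding heavy_def a_def c_def by (simp add: less_imp_le)
  also have "\<dots> \<le> (\<integral>\<^sup>+ y. ennreal (\<Phi> y) * indicator (dcube k x \<inter> {y. l < \<Phi> y}) y + ennreal l * indicator (dcube k x) y \<partial>lborel)"
    unfolding mass_def using nn
    by (intro nn_integral_mono) (auto simp: indicator_def not_less intro: ennreal_leI)
  also have "\<dots> = (\<integral>\<^sup>+ y. ennreal (\<Phi> y) * indicator (dcube k x \<inter> {y. l < \<Phi> y}) y \<partial>lborel) + ennreal l * emeasure lborel (dcube k x)"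
    by (subst nn_integral_add) (simp_all add: nn_integral_cmult)
  also have "\<dots> \<le> ?T + ennreal l * ennreal (side k powr ?n)"
    unfolding l_def by (intro add_left_mono mult_left_mono emeasure_dcube_le) simp
  also have "\<dots> = ?T + ennreal a" using pos by (simp add: ennreal_mult[symmetric] la)
  finally have "ennreal a + ennreal a \<le> ?T + ennreal a" using pos by (simp flip: ennreal_plus)
  then show ?thesis unfolding a_def[symmetric] by (simp add: ennreal_add_left_cancel_le add.commute)
qed

text \<open>The maximal heavy cubes containing a given point shrink as the level \<open>j\<close> grows, so
  \<open>side j * side k powr (-\<beta>)\<close> at least doubles from one level to the next; hence the sum over all
  levels collapses to its largest term, which the truncation bounds by \<open>\<Phi> y / c\<close>.\<close>

lemma sum_max_heavy_le:
  fixes \<beta> \<tau> \<delta> :: real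
  assumes "1 < \<tau>" "0 \<le> \<beta>"
  defines "\<delta> \<equiv> real DIM('a) - \<beta> * \<tau>"
  shows "\<exists>C>0. \<forall>\<Phi> :: 'a::euclidean_space \<Rightarrow> real. \<Phi> \<in> borel_measurable borel \<longrightarrow> (\<forall>y. 0 \<le> \<Phi> y) \<longrightarrow>
       (\<integral>\<^sup>+ (j, k, Q). ennreal (side j powr \<tau> * side k powr \<delta>) * indicator (max_heavy \<beta> \<Phi>) (j, k, Q) \<partial>count_space UNIV)
       \<le> ennreal C * (\<integral>\<^sup>+ y. ennreal (\<Phi> y powr \<tau>) \<partial>lborel)"
proof -
  define c :: real where "c = 1 / (2 * 3 ^ DIM('a))"
  define L :: real where "L = 1 - 2 powr (-(\<tau> - 1))"
  define C where "C = 1 / (c * c powr (\<tau> - 1) * L)"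
  have c: "c > 0" by (simp add: c_def)
  have L: "L > 0" unfolding L_def using two_powr_minus_less_1[of "\<tau> - 1"] assms(1) by simp
  have C: "C > 0" unfolding C_def using c L by simp
  show ?thesis
  proof (intro exI[of _ C] conjI C allI impI)
    fix \<Phi> :: "'a \<Rightarrow> real"
    assume \<Phi>[measurable]: "\<Phi> \<in> borel_measurable borel" and "\<forall>y. 0 \<le> \<Phi> y"
    then have nn: "0 \<le> \<Phi> y" for y by simp
    define M where "M = max_heavy \<beta> \<Phi>"
    define v where "v e = (case e of (j, k, Q) \<Rightarrow> side j * side k powr (-\<beta>))" for e :: "int \<times> int \<times> 'a set"
    define g where "g e y = ennreal (v e powr (\<tau> - 1) / c) * (ennreal (\<Phi> y) * indicator (snd (snd e) \<inter> {y. c * v e < \<Phi> y}) y)"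
      for e :: "int \<times> int \<times> 'a set" and y
    have vpos: "v e > 0" for e by (auto simp: v_def split: prod.splits)
    have term_le: "ennreal (side j powr \<tau> * side k powr \<delta>) \<le> (\<integral>\<^sup>+ y. g (j, k, Q) y \<partial>lborel)"
      if e: "(j, k, Q) \<in> M" for j k Q
    proof -
      obtain x where Q: "Q = dcube k x" and h: "heavy \<beta> \<Phi> j k x"
        using e by (auto simp: M_def max_heavy_def)
      \<comment> \<open>By the choice of \<open>\<delta>\<close> the weight splits into
        \<open>v (j, k, Q) powr (\<tau> - 1)\<close> and a multiple of the lower bound in
        \<open>heavy_truncate\<close>. The second factor becomes an integral, the first stays for
        the lacunary sum.\<close>
      have "side j powr \<tau> * side k powr \<delta>
        = (side j powr (\<tau> - 1) * side j powr 1) * (side k powr (- \<beta> * (\<tau> - 1)) * side k powr (real DIM('a) - \<beta>))"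
        unfolding powr_add[symmetric] \<delta>_def by (simp add: algebra_simps)
      also have "\<dots> = v (j, k, Q) powr (\<tau> - 1) / c * (c * side j * side k powr (real DIM('a) - \<beta>))"
        unfolding v_def using c by (simp add: powr_mult powr_powr)
      finally have "ennreal (side j powr \<tau> * side k powr \<delta>)
        = ennreal (v (j, k, Q) powr (\<tau> - 1) / c) * ennreal (c * side j * side k powr (real DIM('a) - \<beta>))"
        using c by (simp add: ennreal_mult[symmetric])
      also have "\<dots> \<le> ennreal (v (j, k, Q) powr (\<tau> - 1) / c) *
         (\<integral>\<^sup>+ y. ennreal (\<Phi> y) * indicator (dcube k x \<inter> {y. c * (side j * side k powr (-\<beta>)) < \<Phi> y}) y \<partial>lborel)"
        unfolding c_def by (intro mult_left_mono heavy_truncate[OF \<Phi> nn h]) simp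
      also have "\<dots> = (\<integral>\<^sup>+ y. g (j, k, Q) y \<partial>lborel)"
        unfolding g_def Q v_def by (simp add: nn_integral_cmult)
      finally show ?thesis .
    qed
    have inner: "(\<integral>\<^sup>+ e. g e y \<partial>count_space M) \<le> ennreal C * ennreal (\<Phi> y powr \<tau>)" for y
    proof (rule nn_integral_count_space_le)
      show "countable M" unfolding M_def by (rule countable_max_heavy)
      fix F assume F: "finite F" "F \<subseteq> M"
      \<comment> \<open>At a fixed \<open>y\<close> only cubes that contain \<open>y\<close> and
        have \<open>v e\<close> below \<open>\<Phi> y / c\<close> contribute, and this caps the
        lacunary family.\<close>
      define F' where "F' = {e\<in>F. y \<in> snd (snd e) \<and> c * v e < \<Phi> y}"
      have F': "finite F'" unfolding F'_def using F by simp
      have "(\<Sum>e\<in>F. g e y) = (\<Sum>e\<in>F'. g e y)"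
        by (rule sum.mono_neutral_right) (use F in \<open>auto simp: F'_def g_def\<close>)
      also have "\<dots> = (\<Sum>e\<in>F'. ennreal (v e powr (\<tau> - 1) / c * \<Phi> y))"
        using c nn by (intro sum.cong) (auto simp: F'_def g_def simp flip: ennreal_mult)
      also have "\<dots> = ennreal (\<Phi> y / c * (\<Sum>e\<in>F'. v e powr (\<tau> - 1)))"
        using c nn by (subst sum_ennreal) (auto simp: sum_distrib_left intro!: arg_cong[where f = ennreal] sum.cong)
      also have "\<dots> \<le> ennreal (C * \<Phi> y powr \<tau>)"
      proof (cases "\<Phi> y = 0")
        case True
        then show ?thesis by simp
      next
        case False
        then have y: "\<Phi> y > 0" using nn[of y] by simp
        have "(\<Sum>e\<in>F'. v e powr (\<tau> - 1)) \<le> (\<Phi> y / c) powr (\<tau> - 1) / (1 - 2 powr (-(\<tau> - 1)))"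
        proof (rule lacunary_sum_le)
          fix e assume "e \<in> F'"
          then show "v e \<le> \<Phi> y / c" using c by (auto simp: F'_def field_simps)
        next
          fix e e' assume e: "e \<in> F'" "e' \<in> F'" "e \<noteq> e'"
          obtain j k Q where ee: "e = (j, k, Q)" by (cases e)
          obtain j' k' Q' where ee': "e' = (j', k', Q')" by (cases e')
          have m: "(j, k, Q) \<in> M" "y \<in> Q" "(j', k', Q') \<in> M" "y \<in> Q'"
            using e F by (auto simp: F'_def ee ee')
          have shrink: "2 * v (i, l, R) \<le> v (i', l', R')"
            if "(i, l, R) \<in> M" "y \<in> R" "(i', l', R') \<in> M" "y \<in> R'" "i < i'" for i l R i' l' R'
          proof -
            have "heavy \<beta> \<Phi> i l' y"
              using max_heavyD(2)[of i' l' R' \<beta> \<Phi> y] that heavy_antimono[of i i'] by (simp add: M_def)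
            then have "l' \<le> l" using max_heavyD(3)[of i l R \<beta> \<Phi> y] that by (simp add: M_def)
            then have "side l powr (-\<beta>) \<le> side l' powr (-\<beta>)"
              using assms(2) by (intro powr_mono2') (simp_all add: side_mono)
            moreover have "2 * side i \<le> side i'"
              using side_mono[of "i + 1" i'] \<open>i < i'\<close> by (simp add: side_add_1)
            ultimately have "(2 * side i) * side l powr (-\<beta>) \<le> side i' * side l' powr (-\<beta>)"
              by (intro mult_mono) simp_all
            then show ?thesis by (simp add: v_def)
          qed
          \<comment> \<open>Two maximal heavy cubes of one level that share the point
            \<open>y\<close> coincide, so distinct members of \<open>F'\<close> have distinct
            levels.\<close>
          have "j \<noteq> j'"
          proof
            assume jj: "j = j'"
            have "k = k'"
              using max_heavyD(2,3)[of j k Q \<beta> \<Phi> y] max_heavyD(2,3)[of j k' Q' \<beta> \<Phi> y] m jj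
              by (simp add: M_def order_antisym)
            then have "Q = Q'"
              using max_heavyD(1)[of j k Q \<beta> \<Phi> y] max_heavyD(1)[of j k' Q' \<beta> \<Phi> y] m jj by (simp add: M_def)
            then show False using \<open>e \<noteq> e'\<close> \<open>k = k'\<close> jj by (simp add: ee ee')
          qed
          then show "2 * v e \<le> v e' \<or> 2 * v e' \<le> v e"
            using shrink m unfolding ee ee' by (metis linorder_neqE)
        qed (use F' assms(1) y c vpos in auto)
        then have "\<Phi> y / c * (\<Sum>e\<in>F'. v e powr (\<tau> - 1)) \<le> \<Phi> y / c * ((\<Phi> y / c) powr (\<tau> - 1) / L)"
          unfolding L_def using y c by (intro mult_left_mono) auto
        also have "\<dots> = C * (\<Phi> y powr 1 * \<Phi> y powr (\<tau> - 1))"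
          unfolding C_def using y c by (simp add: powr_divide)
        also have "\<dots> = C * \<Phi> y powr \<tau>" unfolding powr_add[symmetric] by simp
        finally show ?thesis by (rule ennreal_leI)
      qed
      finally show "(\<Sum>e\<in>F. g e y) \<le> ennreal C * ennreal (\<Phi> y powr \<tau>)"
        using C by (simp add: ennreal_mult)
    qed
    have Qm: "snd (snd e) \<in> sets borel" if "e \<in> M" for e
      using that by (auto simp: M_def max_heavy_def)
    have gm: "g e \<in> borel_measurable lborel" if "e \<in> M" for e
      using Qm[OF that] unfolding g_def[abs_def] by measurable
    have "(\<integral>\<^sup>+ (j, k, Q). ennreal (side j powr \<tau> * side k powr \<delta>) * indicator M (j, k, Q) \<partial>count_space UNIV)
      \<le> (\<integral>\<^sup>+ e. (\<integral>\<^sup>+ y. g e y \<partial>lborel) * indicator M e \<partial>count_space UNIV)"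
      by (intro nn_integral_mono) (auto simp: indicator_def term_le)
    also have "\<dots> = (\<integral>\<^sup>+ e. (\<integral>\<^sup>+ y. g e y \<partial>lborel) \<partial>count_space M)"
      by (simp add: nn_integral_count_space_indicator)
    also have "\<dots> = (\<integral>\<^sup>+ y. (\<integral>\<^sup>+ e. g e y \<partial>count_space M) \<partial>lborel)"
      by (rule nn_integral_count_space_nn_integral[symmetric, OF countable_max_heavy[of \<beta> \<Phi>, folded M_def] gm])
    also have "\<dots> \<le> (\<integral>\<^sup>+ y. ennreal C * ennreal (\<Phi> y powr \<tau>) \<partial>lborel)"
      by (intro nn_integral_mono inner)
    also have "\<dots> = ennreal C * (\<integral>\<^sup>+ y. ennreal (\<Phi> y powr \<tau>) \<partial>lborel)"
      by (simp add: nn_integral_cmult)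
    finally show "(\<integral>\<^sup>+ (j, k, Q). ennreal (side j powr \<tau> * side k powr \<delta>) * indicator (max_heavy \<beta> \<Phi>) (j, k, Q) \<partial>count_space UNIV)
         \<le> ennreal C * (\<integral>\<^sup>+ y. ennreal (\<Phi> y powr \<tau>) \<partial>lborel)"
      unfolding M_def .
  qed
qed

lemma side_floor_log:
  assumes "0 < u"
  shows "side \<lfloor>log 2 u\<rfloor> \<le> u" "u < side (\<lfloor>log 2 u\<rfloor> + 1)"
proof -
  have "2 powr real_of_int \<lfloor>log 2 u\<rfloor> \<le> 2 powr log 2 u" by (intro powr_mono) auto
  then show "side \<lfloor>log 2 u\<rfloor> \<le> u" using assms by (simp add: side_def)
  have "log 2 u < real_of_int (\<lfloor>log 2 u\<rfloor> + 1)" by linarith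
  then have "2 powr log 2 u < 2 powr real_of_int (\<lfloor>log 2 u\<rfloor> + 1)" by (intro powr_less_mono) auto
  then show "u < side (\<lfloor>log 2 u\<rfloor> + 1)" using assms by (simp add: side_def)
qed

text \<open>The integrand is the content of the set where \<open>A\<close> times the power
  \<open>\<tau>\<close> of the maximal function exceeds \<open>t\<close>. The free factor
  \<open>A\<close> later absorbs the constants of the pointwise bound for the potential.\<close>

lemma choquet_frac_max_le:
  fixes \<beta> \<tau> \<delta> :: real
  assumes "1 < \<tau>" "0 \<le> \<beta>" "\<beta> * \<tau> < real DIM('a)"
  defines "\<delta> \<equiv> real DIM('a) - \<beta> * \<tau>"
  shows "\<exists>C>0. \<forall>(\<Phi> :: 'a::euclidean_space \<Rightarrow> real) A. \<Phi> \<in> borel_measurable borel \<longrightarrow> (\<forall>y. 0 \<le> \<Phi> y) \<longrightarrow>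
       (\<integral>\<^sup>+ y. ennreal (\<Phi> y powr \<tau>) \<partial>lborel) \<le> 1 \<longrightarrow> 0 < A \<longrightarrow>
       (\<integral>\<^sup>+ t\<in>{0<..}. hausdorff_content \<delta> {x. ennreal ((t / A) powr (1 / \<tau>)) < frac_max \<beta> \<Phi> x} \<partial>lborel)
       \<le> ennreal (C * A)"
proof -
  obtain C :: real where C: "C > 0" and
    C_le: "\<forall>\<Phi> :: 'a \<Rightarrow> real. \<Phi> \<in> borel_measurable borel \<longrightarrow> (\<forall>y. 0 \<le> \<Phi> y) \<longrightarrow>
       (\<integral>\<^sup>+ (j, k, Q). ennreal (side j powr \<tau> * side k powr \<delta>) * indicator (max_heavy \<beta> \<Phi>) (j, k, Q) \<partial>count_space UNIV)
       \<le> ennreal C * (\<integral>\<^sup>+ y. ennreal (\<Phi> y powr \<tau>) \<partial>lborel)"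
    using sum_max_heavy_le[OF assms(1,2), where 'a = 'a] unfolding \<delta>_def by blast
  define D where "D = (3 * real DIM('a)) powr \<delta>"
  have D: "D > 0" by (simp add: D_def)
  show ?thesis
  proof (intro exI[of _ "2 powr \<tau> * D * C"] conjI allI impI)
    show "2 powr \<tau> * D * C > 0" using C D by simp
  next
    fix \<Phi> :: "'a \<Rightarrow> real" and A :: real
    assume "\<Phi> \<in> borel_measurable borel" "\<forall>y. 0 \<le> \<Phi> y"
    then have \<Phi>: "\<Phi> \<in> borel_measurable borel" "\<And>y. 0 \<le> \<Phi> y" by auto
    assume int: "(\<integral>\<^sup>+ y. ennreal (\<Phi> y powr \<tau>) \<partial>lborel) \<le> 1" and A: "0 < A"
    define E where "E j = {x. ennreal (side j) < frac_max \<beta> \<Phi> x}" for j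
    define H where "H j = hausdorff_content \<delta> (E j)" for j
    \<comment> \<open>The values \<open>t\<close> whose level
      \<open>(t / A) powr (1 / \<tau>)\<close> lies between \<open>side j\<close> and
      \<open>side (j + 1)\<close>. The length of this interval is the source of the factor
      \<open>2 powr \<tau>\<close>.\<close>
    define I where "I j = {A * side j powr \<tau> ..< A * side (j + 1) powr \<tau>}" for j
    \<comment> \<open>Domination by step functions in \<open>t\<close> comes first, so that
      Tonelli's theorem is applied to measurable integrands only.\<close>
    have pt: "hausdorff_content \<delta> {x. ennreal ((t / A) powr (1 / \<tau>)) < frac_max \<beta> \<Phi> x} * indicator {0<..} t
      \<le> (\<integral>\<^sup>+ j. H j * indicator (I j) t \<partial>count_space UNIV)" for t :: real
    proof (cases "t > 0")
      case True
      define u where "u = (t / A) powr (1 / \<tau>)"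
      define j where "j = \<lfloor>log 2 u\<rfloor>"
      have u: "u > 0" unfolding u_def using True A by simp
      have tu: "t = A * u powr \<tau>" unfolding u_def using True A assms(1) by (simp add: powr_powr)
      have ju: "side j \<le> u" "u < side (j + 1)" unfolding j_def using side_floor_log[OF u] by auto
      have "t \<in> I j"
        unfolding I_def tu using ju A u assms(1) by (auto intro!: powr_mono2 powr_less_mono2)
      have "{x. ennreal u < frac_max \<beta> \<Phi> x} \<subseteq> E j"
        unfolding E_def using ju(1) by (auto intro: le_less_trans[OF ennreal_leI])
      then have "hausdorff_content \<delta> {x. ennreal u < frac_max \<beta> \<Phi> x} \<le> H j * indicator (I j) t"
        unfolding H_def using \<open>t \<in> I j\<close> by (simp add: hausdorff_content_mono)
      also have "\<dots> \<le> (\<integral>\<^sup>+ j. H j * indicator (I j) t \<partial>count_space UNIV)"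
        by (rule nn_integral_count_space_member_le) simp
      finally show ?thesis using True unfolding u_def by simp
    qed simp
    have H_le: "H j \<le> (\<integral>\<^sup>+ (k, Q). ennreal ((3 * DIM('a) * side k) powr \<delta>) * indicator (max_heavy \<beta> \<Phi>) (j, k, Q) \<partial>count_space UNIV)" for j
      unfolding H_def E_def by (rule content_superlevel_le[OF \<Phi> assms(1,3) int])
    have emI: "emeasure lborel (I j) \<le> ennreal (A * 2 powr \<tau> * side j powr \<tau>)" for j
    proof -
      have "emeasure lborel (I j) \<le> ennreal (A * side (j + 1) powr \<tau> - A * side j powr \<tau>)"
        unfolding I_def using A assms(1) by (subst emeasure_lborel_Ico) (auto intro!: powr_mono2 side_mono)
      also have "\<dots> \<le> ennreal (A * side (j + 1) powr \<tau>)"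
        using A by (intro ennreal_leI) simp
      finally show ?thesis by (simp add: side_add_1 powr_mult mult.assoc)
    qed
    have "(\<integral>\<^sup>+ t\<in>{0<..}. hausdorff_content \<delta> {x. ennreal ((t / A) powr (1 / \<tau>)) < frac_max \<beta> \<Phi> x} \<partial>lborel)
      \<le> (\<integral>\<^sup>+ t. (\<integral>\<^sup>+ j. H j * indicator (I j) t \<partial>count_space UNIV) \<partial>lborel)"
      by (intro nn_integral_mono pt)
    also have "\<dots> = (\<integral>\<^sup>+ j. (\<integral>\<^sup>+ t. H j * indicator (I j) t \<partial>lborel) \<partial>count_space UNIV)"
      by (rule nn_integral_count_space_nn_integral) (auto simp: I_def)
    also have "\<dots> = (\<integral>\<^sup>+ j. H j * emeasure lborel (I j) \<partial>count_space UNIV)"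
      by (intro nn_integral_cong nn_integral_cmult_indicator) (simp add: I_def)
    also have "\<dots> \<le> (\<integral>\<^sup>+ j. (\<integral>\<^sup>+ (k, Q). ennreal (A * 2 powr \<tau> * D) *
        (ennreal (side j powr \<tau> * side k powr \<delta>) * indicator (max_heavy \<beta> \<Phi>) (j, k, Q)) \<partial>count_space UNIV) \<partial>count_space UNIV)"
    proof (intro nn_integral_mono)
      fix j
      have "H j * emeasure lborel (I j) \<le> (\<integral>\<^sup>+ (k, Q). ennreal ((3 * DIM('a) * side k) powr \<delta>) * indicator (max_heavy \<beta> \<Phi>) (j, k, Q) \<partial>count_space UNIV)
          * ennreal (A * 2 powr \<tau> * side j powr \<tau>)"
        by (intro mult_mono H_le emI) auto
      also have "\<dots> = (\<integral>\<^sup>+ e. (case e of (k, Q) \<Rightarrow> ennreal ((3 * DIM('a) * side k) powr \<delta>) * indicator (max_heavy \<beta> \<Phi>) (j, k, Q))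
          * ennreal (A * 2 powr \<tau> * side j powr \<tau>) \<partial>count_space UNIV)"
        by (rule nn_integral_multc[symmetric]) simp
      also have "\<dots> = (\<integral>\<^sup>+ (k, Q). ennreal (A * 2 powr \<tau> * D) *
        (ennreal (side j powr \<tau> * side k powr \<delta>) * indicator (max_heavy \<beta> \<Phi>) (j, k, Q)) \<partial>count_space UNIV)"
        using A D by (intro nn_integral_cong)
          (auto simp: indicator_def D_def powr_mult mult_ac simp flip: ennreal_mult split: prod.splits)
      finally show "H j * emeasure lborel (I j) \<le> (\<integral>\<^sup>+ (k, Q). ennreal (A * 2 powr \<tau> * D) *
        (ennreal (side j powr \<tau> * side k powr \<delta>) * indicator (max_heavy \<beta> \<Phi>) (j, k, Q)) \<partial>count_space UNIV)" .
    qed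
    also have "\<dots> = (\<integral>\<^sup>+ e. (case e of (j, k, Q) \<Rightarrow> ennreal (A * 2 powr \<tau> * D) *
        (ennreal (side j powr \<tau> * side k powr \<delta>) * indicator (max_heavy \<beta> \<Phi>) (j, k, Q))) \<partial>count_space UNIV)"
      by (subst nn_integral_fst_count_space[symmetric]) simp
    also have "\<dots> = ennreal (A * 2 powr \<tau> * D) * (\<integral>\<^sup>+ (j, k, Q).
        ennreal (side j powr \<tau> * side k powr \<delta>) * indicator (max_heavy \<beta> \<Phi>) (j, k, Q) \<partial>count_space UNIV)"
      by (subst nn_integral_cmult[symmetric]) (auto intro!: nn_integral_cong split: prod.splits)
    also have "\<dots> \<le> ennreal (A * 2 powr \<tau> * D) * (ennreal C * 1)"
    proof (intro mult_left_mono)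
      show "(\<integral>\<^sup>+ (j, k, Q). ennreal (side j powr \<tau> * side k powr \<delta>) * indicator (max_heavy \<beta> \<Phi>) (j, k, Q) \<partial>count_space UNIV)
        \<le> ennreal C * 1"
        using C_le \<Phi> by (intro order_trans[OF _ mult_left_mono[OF int]]) auto
    qed simp
    also have "\<dots> = ennreal (2 powr \<tau> * D * C * A)"
      using A D C by (simp add: ennreal_mult[symmetric] mult_ac)
    finally show "(\<integral>\<^sup>+ t\<in>{0<..}. hausdorff_content \<delta> {x. ennreal ((t / A) powr (1 / \<tau>)) < frac_max \<beta> \<Phi> x} \<partial>lborel)
       \<le> ennreal (2 powr \<tau> * D * C * A)" .
  qed
qed

section \<open>Pointwise bounds for the Riesz potential\<close>

lemma ennpowr_ennreal: "0 \<le> r \<Longrightarrow> ennreal r ennpowr a = ennreal (r powr a)"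
  by (simp add: ennpowr_def)

lemma ennpowr_top [simp]: "top ennpowr a = top"
  by (simp add: ennpowr_def)

lemma ennpowr_0 [simp]: "0 ennpowr a = 0"
  by (simp add: ennpowr_def)

lemma ennpowr_mono:
  assumes "x \<le> y" "0 < a"
  shows "x ennpowr a \<le> y ennpowr a"
proof (cases "y = top")
  case False
  then have "x \<noteq> top" using assms(1) by (auto simp: top_unique)
  then show ?thesis using assms False
    by (auto simp: ennpowr_def enn2real_mono less_top intro!: ennreal_leI powr_mono2)
qed (simp add: ennpowr_def)

lemma ennpowr_mult_ennreal:
  assumes "0 < c" "0 < a"
  shows "(ennreal c * x) ennpowr a = ennreal (c powr a) * x ennpowr a"
proof (cases x)
  case (real r)
  then show ?thesis using assms by (simp add: ennpowr_ennreal ennreal_mult[symmetric] powr_mult)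
next
  case top
  then show ?thesis using assms by (simp add: ennreal_mult_top)
qed

lemma measurable_ennpowr [measurable]:
  assumes [measurable]: "f \<in> borel_measurable M"
  shows "(\<lambda>x. f x ennpowr a) \<in> borel_measurable M"
  unfolding ennpowr_def by measurable

text \<open>This turns estimates for positive real bounds \<open>A\<close> into estimates by
  \<open>x\<close> itself: for \<open>x = 0\<close> by letting \<open>A\<close> tend to zero, and
  for \<open>x = top\<close> because the right-hand side is infinite.\<close>

lemma le_ennpowrI:
  assumes "\<And>A. 0 < A \<Longrightarrow> x \<le> ennreal A \<Longrightarrow> y \<le> ennreal (C * A powr \<eta>)" "0 < \<eta>" "0 < C"
  shows "y \<le> ennreal C * x ennpowr \<eta>"
proof (cases x)
  case top
  then show ?thesis using assms(3) by (simp add: ennreal_mult_top)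
next
  case (real r)
  show ?thesis
  proof (cases "r = 0")
    case False
    then show ?thesis using assms(1)[of r] real assms(3) by (simp add: ennpowr_ennreal ennreal_mult)
  next
    case True
    have le: "y \<le> ennreal e" if "e > 0" for e
    proof -
      have "y \<le> ennreal (C * ((e / C) powr (1 / \<eta>)) powr \<eta>)"
        using that assms(3) True real by (intro assms(1)) auto
      then show ?thesis using that assms(2,3) by (simp add: powr_powr)
    qed
    have "y \<le> 0"
    proof (rule ennreal_le_epsilon)
      fix e :: real assume "0 < e"
      then show "y \<le> 0 + ennreal e" using le[of e] by simp
    qed
    then show ?thesis by simp
  qed
qed

lemma riesz_potential_mono:
  assumes "\<And>y. g y \<le> h y"
  shows "riesz_potential \<alpha> g x \<le> riesz_potential \<alpha> h x"
  unfolding riesz_potential_def using assms by (intro nn_integral_mono divide_right_mono_ennreal)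

text \<open>For \<open>y\<close> different from \<open>x\<close>, a single scale with
  \<open>side k\<close> between \<open>norm (x - y)\<close> and twice that number dominates the
  kernel; the remaining terms only enlarge the sum.\<close>

lemma riesz_potential_le_dyadic_sum:
  fixes g :: "'a::euclidean_space \<Rightarrow> ennreal" and \<alpha> :: real
  assumes [measurable]: "g \<in> borel_measurable borel" and "\<alpha> < real DIM('a)"
  shows "riesz_potential \<alpha> g x \<le> ennreal (2 powr (real DIM('a) - \<alpha>)) *
    (\<integral>\<^sup>+ k. ennreal (side k powr (\<alpha> - real DIM('a))) * (\<integral>\<^sup>+ y. g y * indicator (tcube k x) y \<partial>lborel) \<partial>count_space UNIV)"
proof -
  let ?n = "real DIM('a)"
  define a where "a = ?n - \<alpha>"
  have a: "a > 0" using assms(2) by (simp add: a_def)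
  have pt: "g y / ennreal (norm (x - y) powr a)
     \<le> ennreal (2 powr a) * (\<integral>\<^sup>+ k. ennreal (side k powr (-a)) * (g y * indicator (tcube k x) y) \<partial>count_space UNIV)"
    if "y \<noteq> x" for y
  proof -
    define r where "r = norm (x - y)"
    have r: "r > 0" using that by (simp add: r_def)
    \<comment> \<open>The shift by one puts \<open>side k\<close> above \<open>norm (x - y)\<close>,
      as \<open>mem_tcubeI\<close> requires, at the price of a factor two that becomes
      \<open>2 powr a\<close>.\<close>
    define k where "k = \<lfloor>log 2 r\<rfloor> + 1"
    have k: "side k \<le> 2 * r" "r < side k"
      using side_floor_log[OF r] by (simp_all add: k_def side_add_1)
    have "1 / r powr a \<le> 2 powr a * side k powr (-a)"
    proof -
      have "side k powr a \<le> (2 * r) powr a" using k(1) a by (intro powr_mono2) auto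
      then show ?thesis using r by (simp add: powr_mult powr_minus field_simps)
    qed
    then have "ennreal (1 / r powr a) * g y \<le> ennreal (2 powr a * side k powr (-a)) * g y"
      by (intro mult_right_mono ennreal_leI) auto
    also have "\<dots> = ennreal (2 powr a) * (ennreal (side k powr (-a)) * (g y * indicator (tcube k x) y))"
      using mem_tcubeI[of x y k] k(2) by (simp add: r_def ennreal_mult mult.assoc)
    also have "\<dots> \<le> ennreal (2 powr a) * (\<integral>\<^sup>+ k. ennreal (side k powr (-a)) * (g y * indicator (tcube k x) y) \<partial>count_space UNIV)"
      by (intro mult_left_mono nn_integral_count_space_member_le) auto
    finally show ?thesis
      using r by (simp add: r_def[symmetric] divide_ennreal_def inverse_ennreal mult.commute inverse_eq_divide)
  qed
  have "riesz_potential \<alpha> g x = (\<integral>\<^sup>+ y. g y / ennreal (norm (x - y) powr a) \<partial>lborel)"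
    unfolding riesz_potential_def a_def by (simp add: nn_integral_completion)
  also have "\<dots> \<le> (\<integral>\<^sup>+ y. ennreal (2 powr a) * (\<integral>\<^sup>+ k. ennreal (side k powr (-a)) * (g y * indicator (tcube k x) y) \<partial>count_space UNIV) \<partial>lborel)"
  proof (rule nn_integral_mono_AE)
    show "AE y in lborel. g y / ennreal (norm (x - y) powr a) \<le> ennreal (2 powr a) *
        (\<integral>\<^sup>+ k. ennreal (side k powr (-a)) * (g y * indicator (tcube k x) y) \<partial>count_space UNIV)"
      using AE_lborel_singleton[of x] by eventually_elim (use pt in metis)
  qed
  also have "\<dots> = (\<integral>\<^sup>+ y. (\<integral>\<^sup>+ k. ennreal (2 powr a) * (ennreal (side k powr (-a)) * (g y * indicator (tcube k x) y)) \<partial>count_space UNIV) \<partial>lborel)"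
    by (simp add: nn_integral_cmult)
  also have "\<dots> = (\<integral>\<^sup>+ k. (\<integral>\<^sup>+ y. ennreal (2 powr a) * (ennreal (side k powr (-a)) * (g y * indicator (tcube k x) y)) \<partial>lborel) \<partial>count_space UNIV)"
    by (rule nn_integral_count_space_nn_integral) auto
  also have "\<dots> = ennreal (2 powr a) * (\<integral>\<^sup>+ k. ennreal (side k powr (-a)) * (\<integral>\<^sup>+ y. g y * indicator (tcube k x) y \<partial>lborel) \<partial>count_space UNIV)"
    by (simp add: nn_integral_cmult)
  finally show ?thesis by (simp add: a_def)
qed

text \<open>Hedberg's argument in a form that serves both applications: \<open>c = \<kappa>\<close>
  for the inner potential and \<open>c = 0\<close> for the outer one. The factor \<open>D\<close> is
  kept apart from \<open>X\<close> because it enters linearly.\<close>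

lemma riesz_potential_le_of_tcube_bounds:
  fixes \<alpha> b c :: real
  assumes "c < \<alpha>" "\<alpha> < real DIM('a)" "\<alpha> - c < b"
  shows "\<exists>C>0. \<forall>(g :: 'a::euclidean_space \<Rightarrow> ennreal) x X D. g \<in> borel_measurable borel \<longrightarrow> 0 < X \<longrightarrow> 0 \<le> D \<longrightarrow>
    (\<forall>k. (\<integral>\<^sup>+ y. g y * indicator (tcube k x) y \<partial>lborel)
       \<le> ennreal (D * side k powr (real DIM('a) - c) * min X (side k powr (-b)))) \<longrightarrow>
    riesz_potential \<alpha> g x \<le> ennreal (C * D * X powr (1 - (\<alpha> - c) / b))"
proof -
  let ?n = "real DIM('a)"
  obtain C :: real where C: "C > 0"
    and CX: "\<And>X. X > 0 \<Longrightarrow> (\<integral>\<^sup>+ k. ennreal (side k powr (\<alpha> - c) * min X (side k powr (-b))) \<partial>count_space UNIV)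
       \<le> ennreal (C * X powr (1 - (\<alpha> - c) / b))"
    using dyadic_sum_min_le[of "\<alpha> - c" b] assms by auto
  show ?thesis
  proof (intro exI[of _ "2 powr (?n - \<alpha>) * C"] conjI allI impI)
    show "2 powr (?n - \<alpha>) * C > 0" using C by simp
  next
    fix g :: "'a \<Rightarrow> ennreal" and x and X D :: real
    assume g: "g \<in> borel_measurable borel" and X: "0 < X" and D: "0 \<le> D"
      and le: "\<forall>k. (\<integral>\<^sup>+ y. g y * indicator (tcube k x) y \<partial>lborel)
       \<le> ennreal (D * side k powr (?n - c) * min X (side k powr (-b)))"
    have "riesz_potential \<alpha> g x \<le> ennreal (2 powr (?n - \<alpha>)) *
      (\<integral>\<^sup>+ k. ennreal (side k powr (\<alpha> - ?n)) * (\<integral>\<^sup>+ y. g y * indicator (tcube k x) y \<partial>lborel) \<partial>count_space UNIV)"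
      by (rule riesz_potential_le_dyadic_sum[OF g assms(2)])
    also have "\<dots> \<le> ennreal (2 powr (?n - \<alpha>)) *
      (\<integral>\<^sup>+ k. ennreal D * ennreal (side k powr (\<alpha> - c) * min X (side k powr (-b))) \<partial>count_space UNIV)"
    proof (intro mult_left_mono nn_integral_mono)
      fix k
      have "ennreal (side k powr (\<alpha> - ?n)) * (\<integral>\<^sup>+ y. g y * indicator (tcube k x) y \<partial>lborel)
        \<le> ennreal (side k powr (\<alpha> - ?n)) * ennreal (D * side k powr (?n - c) * min X (side k powr (-b)))"
        using le by (intro mult_left_mono) auto
      also have "\<dots> = ennreal (D * (side k powr (\<alpha> - ?n) * side k powr (?n - c)) * min X (side k powr (-b)))"
        using D X by (simp add: ennreal_mult[symmetric] mult_ac)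
      also have "side k powr (\<alpha> - ?n) * side k powr (?n - c) = side k powr (\<alpha> - c)"
        by (simp add: powr_add[symmetric])
      finally show "ennreal (side k powr (\<alpha> - ?n)) * (\<integral>\<^sup>+ y. g y * indicator (tcube k x) y \<partial>lborel)
        \<le> ennreal D * ennreal (side k powr (\<alpha> - c) * min X (side k powr (-b)))"
        using D X by (simp add: ennreal_mult[symmetric] mult_ac)
    qed auto
    also have "\<dots> = ennreal (2 powr (?n - \<alpha>)) * (ennreal D *
      (\<integral>\<^sup>+ k. ennreal (side k powr (\<alpha> - c) * min X (side k powr (-b))) \<partial>count_space UNIV))"
      by (simp add: nn_integral_cmult)
    also have "\<dots> \<le> ennreal (2 powr (?n - \<alpha>)) * (ennreal D * ennreal (C * X powr (1 - (\<alpha> - c) / b)))"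
      by (intro mult_left_mono CX X) auto
    also have "\<dots> = ennreal (2 powr (?n - \<alpha>) * C * D * X powr (1 - (\<alpha> - c) / b))"
      using C D X by (simp add: ennreal_mult[symmetric] mult_ac)
    finally show "riesz_potential \<alpha> g x \<le> ennreal (2 powr (?n - \<alpha>) * C * D * X powr (1 - (\<alpha> - c) / b))" .
  qed
qed

text \<open>When \<beta> < n / \<tau>, the maximal function gives the better bound on small triples
  and the norm gives the better bound on large ones.\<close>

lemma mass_tcube_le_min:
  fixes \<Phi> :: "'a::euclidean_space \<Rightarrow> real" and \<beta> \<tau> A :: real
  assumes "\<Phi> \<in> borel_measurable borel" "\<And>y. 0 \<le> \<Phi> y" "1 < \<tau>"
    and "(\<integral>\<^sup>+ y. ennreal (\<Phi> y powr \<tau>) \<partial>lborel) \<le> 1"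
    and "0 < A" "frac_max \<beta> \<Phi> x \<le> ennreal A"
  shows "mass \<Phi> (tcube k x) \<le> ennreal (side k powr (real DIM('a) - \<beta>) *
    min A ((3 ^ DIM('a) + 1) * side k powr (\<beta> - real DIM('a) / \<tau>)))"
proof -
  have 1: "mass \<Phi> (tcube k x) \<le> ennreal (side k powr (real DIM('a) - \<beta>) * A)"
    using assms(5,6) by (simp add: frac_max_le_iff mult.commute)
  have "mass \<Phi> (tcube k x) \<le> ennreal ((3 ^ DIM('a) + 1) * side k powr (real DIM('a) - real DIM('a) / \<tau>))"
    by (rule mass_tcube_le_unit[OF assms(1-4)])
  also have "(3 ^ DIM('a) + 1) * side k powr (real DIM('a) - real DIM('a) / \<tau>)
    = side k powr (real DIM('a) - \<beta>) * ((3 ^ DIM('a) + 1) * side k powr (\<beta> - real DIM('a) / \<tau>))"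
    by (simp add: powr_add[symmetric])
  finally show ?thesis using 1 by (simp add: min_def)
qed

text \<open>Here \<open>q\<close> is the intermediate exponent r of the overview and
  \<open>q * \<tau>\<close> is the Lebesgue exponent. The available mass bounds concern
  \<open>h y powr q\<close>, so a Hoelder step on each triple converts them into bounds for
  \<open>h\<close> before the sum over scales.\<close>

lemma riesz_potential_le_frac_max:
  fixes \<alpha> \<kappa> q \<tau> :: real
  assumes "0 < \<alpha>" "\<kappa> < \<alpha>" "\<alpha> < real DIM('a)" "1 < q" "1 < \<tau>" "\<alpha> * (q * \<tau>) < real DIM('a)"
  shows "\<exists>C>0. \<forall>(h :: 'a::euclidean_space \<Rightarrow> real) x A. h \<in> borel_measurable borel \<longrightarrow> (\<forall>y. 0 \<le> h y) \<longrightarrow>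
    (\<integral>\<^sup>+ y. ennreal (h y powr (q * \<tau>)) \<partial>lborel) \<le> 1 \<longrightarrow> 0 < A \<longrightarrow>
    frac_max (\<kappa> * q) (\<lambda>y. h y powr q) x \<le> ennreal A \<longrightarrow>
    riesz_potential \<alpha> (\<lambda>y. ennreal (h y)) x
      \<le> ennreal (C * A powr (1 / q * (1 - (\<alpha> - \<kappa>) / (real DIM('a) / (q * \<tau>) - \<kappa>))))"
proof -
  let ?n = "real DIM('a)"
  define b where "b = ?n / (q * \<tau>) - \<kappa>"
  have ab: "\<alpha> - \<kappa> < b" unfolding b_def using assms by (simp add: field_simps)
  define K :: real where "K = 3 ^ DIM('a) + 1"
  have K: "K \<ge> 1" by (simp add: K_def)
  obtain C where C: "C > 0" and C_le: "\<forall>(g :: 'a \<Rightarrow> ennreal) x X D. g \<in> borel_measurable borel \<longrightarrow> 0 < X \<longrightarrow> 0 \<le> D \<longrightarrow>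
    (\<forall>k. (\<integral>\<^sup>+ y. g y * indicator (tcube k x) y \<partial>lborel)
       \<le> ennreal (D * side k powr (?n - \<kappa>) * min X (side k powr (-b)))) \<longrightarrow>
    riesz_potential \<alpha> g x \<le> ennreal (C * D * X powr (1 - (\<alpha> - \<kappa>) / b))"
    using riesz_potential_le_of_tcube_bounds[OF assms(2,3) ab] by blast
  \<comment> \<open>One factor \<open>K\<close> comes from the Hoelder step on a triple, the factor
    \<open>K powr (1 / q)\<close> from the root of the mass bound.\<close>
  define D where "D = K * K powr (1 / q)"
  have D: "D > 0" using K by (simp add: D_def)
  show ?thesis
  proof (intro exI[of _ "C * D"] conjI allI impI)
    show "C * D > 0" using C D by simp
  next
    fix h :: "'a \<Rightarrow> real" and x and A :: real
    assume h[measurable]: "h \<in> borel_measurable borel" and "\<forall>y. 0 \<le> h y"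
      and int: "(\<integral>\<^sup>+ y. ennreal (h y powr (q * \<tau>)) \<partial>lborel) \<le> 1" and A: "0 < A"
      and G: "frac_max (\<kappa> * q) (\<lambda>y. h y powr q) x \<le> ennreal A"
    then have nn: "\<And>y. 0 \<le> h y" by simp
    have "(\<integral>\<^sup>+ y. ennreal (h y) * indicator (tcube k x) y \<partial>lborel)
       \<le> ennreal (D * side k powr (?n - \<kappa>) * min (A powr (1 / q)) (side k powr (-b)))" for k
    proof -
      define m where "m = min A (K * side k powr (\<kappa> * q - ?n / \<tau>))"
      define B where "B = side k powr (?n - \<kappa> * q) * m"
      have m: "m > 0" unfolding m_def using A K by simp
      have B: "B > 0" unfolding B_def using m by simp
      have "mass (\<lambda>y. h y powr q) (tcube k x) \<le> ennreal B"
        unfolding B_def m_def K_def using assms int A G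
        by (intro mass_tcube_le_min[where \<tau> = \<tau>]) (simp_all add: powr_powr)
      then have "mass h (tcube k x) \<le> ennreal (K * side k powr (?n - ?n / q) * B powr (1 / q))"
        unfolding K_def by (intro mass_tcube_le nn B assms(4)) simp
      also have "\<dots> \<le> ennreal (D * side k powr (?n - \<kappa>) * min (A powr (1 / q)) (side k powr (-b)))"
      proof (rule ennreal_leI)
        have "m powr (1 / q) \<le> K powr (1 / q) * min (A powr (1 / q)) (side k powr (-b))"
        proof -
          have e: "(\<kappa> * q - ?n / \<tau>) * (1 / q) = - b"
            unfolding b_def using assms by (simp add: field_simps)
          have "m powr (1 / q) \<le> (K * side k powr (\<kappa> * q - ?n / \<tau>)) powr (1 / q)"
            using m assms(4) by (intro powr_mono2) (simp_all add: m_def)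
          also have "\<dots> = K powr (1 / q) * side k powr (-b)"
            using K e by (simp add: powr_mult powr_powr)
          finally have 1: "m powr (1 / q) \<le> K powr (1 / q) * side k powr (-b)" .
          have "m powr (1 / q) \<le> A powr (1 / q)"
            using m assms(4) by (intro powr_mono2) (simp_all add: m_def)
          also have "\<dots> \<le> K powr (1 / q) * A powr (1 / q)"
            using mult_right_mono[OF ge_one_powr_ge_zero[OF K, of "1 / q"], of "A powr (1 / q)"] assms(4) by simp
          finally show ?thesis using 1 by (simp add: min_def)
        qed
        moreover have "B powr (1 / q) = side k powr (?n / q - \<kappa>) * m powr (1 / q)"
          unfolding B_def using m assms(4) by (simp add: powr_mult powr_powr diff_divide_distrib)
        ultimately have "B powr (1 / q) \<le> side k powr (?n / q - \<kappa>) * (K powr (1 / q) * min (A powr (1 / q)) (side k powr (-b)))"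
          by (simp add: mult_left_mono)
        then have "K * side k powr (?n - ?n / q) * B powr (1 / q)
          \<le> K * side k powr (?n - ?n / q) * (side k powr (?n / q - \<kappa>) * (K powr (1 / q) * min (A powr (1 / q)) (side k powr (-b))))"
          using K by (intro mult_left_mono) auto
        also have "\<dots> = D * (side k powr (?n - ?n / q) * side k powr (?n / q - \<kappa>)) * min (A powr (1 / q)) (side k powr (-b))"
          unfolding D_def by (simp only: mult_ac)
        also have "side k powr (?n - ?n / q) * side k powr (?n / q - \<kappa>) = side k powr (?n - \<kappa>)"
          by (simp add: powr_add[symmetric])
        finally show "K * side k powr (?n - ?n / q) * B powr (1 / q)
          \<le> D * side k powr (?n - \<kappa>) * min (A powr (1 / q)) (side k powr (-b))" .
      qed
      finally show ?thesis unfolding mass_def .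
    qed
    then have "riesz_potential \<alpha> (\<lambda>y. ennreal (h y)) x \<le> ennreal (C * D * (A powr (1 / q)) powr (1 - (\<alpha> - \<kappa>) / b))"
      using C_le A D by simp
    also have "(A powr (1 / q)) powr (1 - (\<alpha> - \<kappa>) / b) = A powr (1 / q * (1 - (\<alpha> - \<kappa>) / b))"
      by (rule powr_powr)
    finally show "riesz_potential \<alpha> (\<lambda>y. ennreal (h y)) x
      \<le> ennreal (C * D * A powr (1 / q * (1 - (\<alpha> - \<kappa>) / (?n / (q * \<tau>) - \<kappa>))))"
      unfolding b_def .
  qed
qed

section \<open>Averages of powers of the maximal function\<close>

lemma borel_measurable_nn_integral_count_space:
  fixes f :: "'i \<Rightarrow> 'a \<Rightarrow> ennreal"
  assumes "countable I" and [measurable]: "\<And>i. i \<in> I \<Longrightarrow> f i \<in> borel_measurable M"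
  shows "(\<lambda>x. \<integral>\<^sup>+ i. f i x \<partial>count_space I) \<in> borel_measurable M"
proof (cases "finite I")
  case True
  then show ?thesis by (simp add: nn_integral_count_space_finite)
next
  case False
  then have I: "I \<noteq> {}" by auto
  note bij = bij_betw_from_nat_into[OF \<open>countable I\<close> False]
  have "(\<integral>\<^sup>+ i. f i x \<partial>count_space I) = (\<Sum>n. f (from_nat_into I n) x)" for x
    by (simp add: nn_integral_bij_count_space[symmetric, OF bij] nn_integral_count_space_nat)
  moreover have "f (from_nat_into I n) \<in> borel_measurable M" for n
    by (intro assms(2) from_nat_into I)
  ultimately show ?thesis by simp
qed

text \<open>Membership in a triple is symmetric, so after Fubini each \<open>y\<close> is counted
  with at most the volume of \<open>tcube j y\<close>, and \<open>tcube_trans\<close> keeps these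
  \<open>y\<close> in the next larger triple about \<open>x\<close>.\<close>

lemma nn_integral_mass_tcube_le:
  fixes \<Phi> :: "'a::euclidean_space \<Rightarrow> real"
  assumes [measurable]: "\<Phi> \<in> borel_measurable borel" and "j \<le> k"
  shows "(\<integral>\<^sup>+ z. mass \<Phi> (tcube j z) * indicator (tcube k x) z \<partial>lborel)
    \<le> ennreal (3 ^ DIM('a) * side j powr real DIM('a)) * mass \<Phi> (tcube (k + 1) x)"
proof -
  have ind: "indicator S y = (if y \<in> S then 1 else 0 :: ennreal)" for S and y :: 'a
    by (simp add: indicator_def)
  have [measurable]: "Measurable.pred (borel \<Otimes>\<^sub>M borel) (\<lambda>p. fst p \<in> tcube j (snd p :: 'a))"
    using pred_tcube[of j] by (subst tcube_sym)
  have "(\<integral>\<^sup>+ z. mass \<Phi> (tcube j z) * indicator (tcube k x) z \<partial>lborel)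
    = (\<integral>\<^sup>+ z. \<integral>\<^sup>+ y. ennreal (\<Phi> y) * indicator (tcube j z) y * indicator (tcube k x) z \<partial>lborel \<partial>lborel)"
    unfolding mass_def by (simp add: nn_integral_multc)
  also have "\<dots> = (\<integral>\<^sup>+ y. \<integral>\<^sup>+ z. ennreal (\<Phi> y) * indicator (tcube j z) y * indicator (tcube k x) z \<partial>lborel \<partial>lborel)"
    unfolding ind by (rule lborel_pair.Fubini') (simp add: split_def)
  also have "\<dots> \<le> (\<integral>\<^sup>+ y. \<integral>\<^sup>+ z. (ennreal (\<Phi> y) * indicator (tcube (k + 1) x) y) * indicator (tcube j y) z \<partial>lborel \<partial>lborel)"
  proof (intro nn_integral_mono)
    fix y z :: 'a
    have "y \<in> tcube (k + 1) x" if "y \<in> tcube j z" "z \<in> tcube k x"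
      using that \<open>j \<le> k\<close> by (rule tcube_trans)
    then show "ennreal (\<Phi> y) * indicator (tcube j z) y * indicator (tcube k x) z
      \<le> (ennreal (\<Phi> y) * indicator (tcube (k + 1) x) y) * indicator (tcube j y) z"
      using tcube_sym[of y j z] by (auto simp: indicator_def)
  qed
  also have "\<dots> = (\<integral>\<^sup>+ y. (ennreal (\<Phi> y) * indicator (tcube (k + 1) x) y) * emeasure lborel (tcube j y) \<partial>lborel)"
    by (intro nn_integral_cong nn_integral_cmult_indicator) simp
  also have "\<dots> \<le> (\<integral>\<^sup>+ y. ennreal (3 ^ DIM('a) * side j powr real DIM('a)) * (ennreal (\<Phi> y) * indicator (tcube (k + 1) x) y) \<partial>lborel)"
    unfolding mult.commute[of "ennreal (3 ^ DIM('a) * side j powr real DIM('a))"]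
    by (intro nn_integral_mono mult_left_mono emeasure_tcube_le) simp
  also have "\<dots> = ennreal (3 ^ DIM('a) * side j powr real DIM('a)) * mass \<Phi> (tcube (k + 1) x)"
    unfolding mass_def by (simp add: nn_integral_cmult)
  finally show ?thesis .
qed

text \<open>The supremum over small scales is replaced by a sum of \<open>\<eta>'\<close>-th powers, which is affordable
  because \<open>(n - \<beta>) * \<eta>' < n\<close> makes the sum of the averages converge. The exponent \<open>\<eta>' > 1\<close>
  allows all but one factor of the mass to be estimated by its bound \<open>M\<close>.\<close>

lemma frac_max_ennpowr_le:
  fixes \<Phi> :: "'a::euclidean_space \<Rightarrow> real" and \<beta> \<eta> \<eta>' A M :: real
  assumes "0 \<le> \<beta>" "\<beta> < real DIM('a)" "0 < \<eta>" "\<eta> < \<eta>'" "1 < \<eta>'"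
    and A: "0 < A" and le: "\<And>j. k \<le> j \<Longrightarrow> mass \<Phi> (tcube j x) \<le> ennreal (A * side j powr (real DIM('a) - \<beta>))"
    and z: "z \<in> tcube k x"
  defines "M \<equiv> A * side (k + 1) powr (real DIM('a) - \<beta>)"
  shows "frac_max \<beta> \<Phi> z ennpowr \<eta> \<le> ennreal ((2 ^ DIM('a) * A) powr \<eta>) +
    (\<integral>\<^sup>+ j. ennreal (A powr (\<eta> - \<eta>') * side j powr ((\<beta> - real DIM('a)) * \<eta>') * M powr (\<eta>' - 1)) * mass \<Phi> (tcube j z) \<partial>count_space {..<k})"
    (is "_ \<le> ?B + ?R")
proof (cases "?B + ?R")
  case top
  then show ?thesis by simp
next
  case (real t)
  let ?n = "real DIM('a)"
  have M: "M > 0" unfolding M_def using A by simp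
  have Bt: "(2 ^ DIM('a) * A) powr \<eta> \<le> t"
  proof -
    have "?B \<le> ennreal t" unfolding real(2)[symmetric] by simp
    then show ?thesis using real(1) by simp
  qed
  \<comment> \<open>The power stands outside the supremum, so each competitor \<open>u\<close> is
    compared with \<open>t powr (1 / \<eta>)\<close>.\<close>
  have up: "u \<le> t powr (1 / \<eta>)" if "u powr \<eta> \<le> t" "0 \<le> u" for u
  proof -
    have "(u powr \<eta>) powr (1 / \<eta>) \<le> t powr (1 / \<eta>)" using that assms(3) by (intro powr_mono2) auto
    then show ?thesis using that assms(3) by (simp add: powr_powr)
  qed
  have "frac_max \<beta> \<Phi> z \<le> ennreal (t powr (1 / \<eta>))"
    unfolding frac_max_def
  proof (rule SUP_least)
    fix j :: int
    show "ennreal (side j powr (\<beta> - ?n)) * mass \<Phi> (tcube j z) \<le> ennreal (t powr (1 / \<eta>))"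
    proof (cases "k \<le> j")
      case True
      \<comment> \<open>Recentring from \<open>z\<close> to \<open>x\<close> costs one generation,
        hence a factor \<open>2 powr (?n - \<beta>)\<close>, which is the origin of
        \<open>2 ^ DIM('a)\<close>.\<close>
      have "tcube j z \<subseteq> tcube (j + 1) x"
      proof
        fix y assume "y \<in> tcube j z"
        moreover have "z \<in> tcube j x" using z True tcube_mono by blast
        ultimately show "y \<in> tcube (j + 1) x" by (rule tcube_trans_succ)
      qed
      then have "mass \<Phi> (tcube j z) \<le> mass \<Phi> (tcube (j + 1) x)" by (rule mass_mono)
      also have "\<dots> \<le> ennreal (A * side (j + 1) powr (?n - \<beta>))" using True by (intro le) simp
      finally have "ennreal (side j powr (\<beta> - ?n)) * mass \<Phi> (tcube j z)
        \<le> ennreal (side j powr (\<beta> - ?n)) * ennreal (A * side (j + 1) powr (?n - \<beta>))"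
        by (rule mult_left_mono) simp
      also have "\<dots> = ennreal (A * 2 powr (?n - \<beta>) * (side j powr (\<beta> - ?n) * side j powr (?n - \<beta>)))"
        using A by (simp add: ennreal_mult[symmetric] side_add_1 powr_mult mult_ac)
      also have "side j powr (\<beta> - ?n) * side j powr (?n - \<beta>) = 1"
        by (simp add: powr_add[symmetric])
      also have "ennreal (A * 2 powr (?n - \<beta>) * 1) \<le> ennreal (2 ^ DIM('a) * A)"
      proof (rule ennreal_leI)
        have "2 powr (?n - \<beta>) \<le> 2 powr ?n" using assms(1) by (intro powr_mono) auto
        then show "A * 2 powr (?n - \<beta>) * 1 \<le> 2 ^ DIM('a) * A" using A by (simp add: powr_realpow)
      qed
      also have "\<dots> \<le> ennreal (t powr (1 / \<eta>))" using Bt A by (intro ennreal_leI up) auto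
      finally show ?thesis .
    next
      case False
      then have jk: "j < k" by simp
      have "tcube j z \<subseteq> tcube (k + 1) x" using z jk tcube_trans[of _ j z k x] by auto
      then have "mass \<Phi> (tcube j z) \<le> mass \<Phi> (tcube (k + 1) x)" by (rule mass_mono)
      also have "\<dots> \<le> ennreal M" unfolding M_def by (intro le) simp
      finally have mM: "mass \<Phi> (tcube j z) \<le> ennreal M" .
      then obtain m where m: "mass \<Phi> (tcube j z) = ennreal m" "0 \<le> m"
        by (cases "mass \<Phi> (tcube j z)") (auto simp: top_unique)
      have "m \<le> M" using mM m M by simp
      define u where "u = side j powr (\<beta> - ?n) * m"
      \<comment> \<open>Values up to \<open>A\<close> are covered by the first summand. Above
        \<open>A\<close>, raising the exponent from \<open>\<eta>\<close> to \<open>\<eta>'\<close>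
        costs only the factor \<open>A powr (\<eta> - \<eta>')\<close>.\<close>
      have "u powr \<eta> \<le> t"
      proof (cases "u \<le> A")
        case True
        have "1 * A \<le> 2 ^ DIM('a) * A" using A by (intro mult_right_mono) auto
        then have "u \<le> 2 ^ DIM('a) * A" using True by linarith
        moreover have "0 \<le> u" using m by (simp add: u_def)
        ultimately have "u powr \<eta> \<le> (2 ^ DIM('a) * A) powr \<eta>"
          using assms(3) by (intro powr_mono2) auto
        then show ?thesis using Bt by simp
      next
        case False
        then have uA: "A < u" by simp
        then have mpos: "m > 0" using m A unfolding u_def by (cases "m = 0") auto
        have "u powr \<eta> = u powr (\<eta> - \<eta>') * u powr \<eta>'" by (simp add: powr_add[symmetric])
        also have "\<dots> \<le> A powr (\<eta> - \<eta>') * u powr \<eta>'"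
          using uA A assms(4) by (intro mult_right_mono powr_mono2') auto
        also have "u powr \<eta>' = side j powr ((\<beta> - ?n) * \<eta>') * (m powr (\<eta>' - 1) * m powr 1)"
          unfolding u_def powr_add[symmetric] using mpos by (simp add: powr_mult powr_powr)
        also have "\<dots> \<le> side j powr ((\<beta> - ?n) * \<eta>') * (M powr (\<eta>' - 1) * m powr 1)"
          using \<open>m \<le> M\<close> m assms(5) by (intro mult_left_mono mult_right_mono powr_mono2) auto
        also have "A powr (\<eta> - \<eta>') * \<dots> = A powr (\<eta> - \<eta>') * side j powr ((\<beta> - ?n) * \<eta>') * M powr (\<eta>' - 1) * m"
          using mpos by (simp add: mult_ac)
        finally have "u powr \<eta> \<le> A powr (\<eta> - \<eta>') * side j powr ((\<beta> - ?n) * \<eta>') * M powr (\<eta>' - 1) * m"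
          using A by (simp add: mult_left_mono)
        then have "ennreal (u powr \<eta>) \<le> ennreal (A powr (\<eta> - \<eta>') * side j powr ((\<beta> - ?n) * \<eta>') * M powr (\<eta>' - 1)) * mass \<Phi> (tcube j z)"
          using m by (simp add: ennreal_mult[symmetric] ennreal_leI)
        also have "\<dots> \<le> ?R"
          using jk by (intro nn_integral_count_space_member_le) simp
        also have "\<dots> \<le> ?B + ?R" by simp
        finally show ?thesis unfolding real(2) using real(1) by simp
      qed
      then have "u \<le> t powr (1 / \<eta>)" using m by (intro up) (auto simp: u_def)
      then show ?thesis using m unfolding u_def by (simp add: ennreal_mult[symmetric] ennreal_leI)
    qed
  qed
  then have "frac_max \<beta> \<Phi> z ennpowr \<eta> \<le> ennreal (t powr (1 / \<eta>)) ennpowr \<eta>"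
    by (rule ennpowr_mono) (rule assms(3))
  also have "\<dots> = ennreal t" using real(1) assms(3) by (simp add: ennpowr_ennreal powr_powr)
  finally show ?thesis by (simp add: real(2))
qed

text \<open>The mass bounds are assumed only for triples about \<open>x\<close> of scale at least
  \<open>k\<close>. Hence \<open>A\<close> may depend on \<open>k\<close> in the application, which
  is what preserves decay at large scales.\<close>

lemma nn_integral_frac_max_ennpowr_le:
  fixes \<beta> \<eta> :: real
  assumes "0 < \<beta>" "\<beta> < real DIM('a)" "0 < \<eta>" "(real DIM('a) - \<beta>) * \<eta> < real DIM('a)"
  shows "\<exists>C>0. \<forall>(\<Phi> :: 'a::euclidean_space \<Rightarrow> real) x k A. \<Phi> \<in> borel_measurable borel \<longrightarrow> 0 < A \<longrightarrow>
    (\<forall>j\<ge>k. mass \<Phi> (tcube j x) \<le> ennreal (A * side j powr (real DIM('a) - \<beta>))) \<longrightarrow>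
    (\<integral>\<^sup>+ z. frac_max \<beta> \<Phi> z ennpowr \<eta> * indicator (tcube k x) z \<partial>lborel)
      \<le> ennreal (C * side k powr real DIM('a) * A powr \<eta>)"
proof -
  let ?n = "real DIM('a)"
  \<comment> \<open>Room for \<open>\<eta>'\<close>: \<open>0 < \<beta>\<close> makes the quotient
    exceed \<open>1\<close>, and the assumption on \<open>\<eta>\<close> makes it exceed
    \<open>\<eta>\<close>.\<close>
  have "max 1 \<eta> < ?n / (?n - \<beta>)" using assms by (simp add: field_simps)
  then obtain \<eta>' where "max 1 \<eta> < \<eta>'" "\<eta>' < ?n / (?n - \<beta>)" using dense by blast
  then have \<eta>': "1 < \<eta>'" "\<eta> < \<eta>'" "\<eta>' < ?n / (?n - \<beta>)" by simp_all
  \<comment> \<open>After averaging, scale \<open>j\<close> contributes a multiple of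
    \<open>side j powr e\<close>; as \<open>e\<close> is positive, the sum over \<open>j < k\<close>
    converges.\<close>
  define e where "e = ?n - (?n - \<beta>) * \<eta>'"
  have e: "e > 0" unfolding e_def using \<eta>'(3) assms(2) by (simp add: field_simps)
  have e': "1 - 2 powr (-e) > 0" using two_powr_minus_less_1[OF e] by simp
  define K where "K = 2 powr ((?n - \<beta>) * \<eta>') / (1 - 2 powr (-e))"
  have K: "K > 0" unfolding K_def using e' by simp
  define C where "C = 3 ^ DIM('a) * ((2 ^ DIM('a)) powr \<eta> + K)"
  have C: "C > 0" unfolding C_def using K by (simp add: add_pos_pos)
  show ?thesis
  proof (intro exI[of _ C] conjI C allI impI)
    fix \<Phi> :: "'a \<Rightarrow> real" and x k and A :: real
    assume \<Phi>[measurable]: "\<Phi> \<in> borel_measurable borel" and A: "0 < A"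
      and le: "\<forall>j\<ge>k. mass \<Phi> (tcube j x) \<le> ennreal (A * side j powr (?n - \<beta>))"
    define M where "M = A * side (k + 1) powr (?n - \<beta>)"
    have M: "M > 0" unfolding M_def using A by simp
    define c where "c j = A powr (\<eta> - \<eta>') * side j powr ((\<beta> - ?n) * \<eta>') * M powr (\<eta>' - 1)" for j
    have cpos: "c j \<ge> 0" for j unfolding c_def by simp
    have "(\<integral>\<^sup>+ z. frac_max \<beta> \<Phi> z ennpowr \<eta> * indicator (tcube k x) z \<partial>lborel)
      \<le> (\<integral>\<^sup>+ z. ennreal ((2 ^ DIM('a) * A) powr \<eta>) * indicator (tcube k x) z +
          (\<integral>\<^sup>+ j. ennreal (c j) * (mass \<Phi> (tcube j z) * indicator (tcube k x) z) \<partial>count_space {..<k}) \<partial>lborel)"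
    proof (intro nn_integral_mono)
      fix z
      show "frac_max \<beta> \<Phi> z ennpowr \<eta> * indicator (tcube k x) z \<le> ennreal ((2 ^ DIM('a) * A) powr \<eta>) * indicator (tcube k x) z +
          (\<integral>\<^sup>+ j. ennreal (c j) * (mass \<Phi> (tcube j z) * indicator (tcube k x) z) \<partial>count_space {..<k})"
      proof (cases "z \<in> tcube k x")
        case True
        have "frac_max \<beta> \<Phi> z ennpowr \<eta> \<le> ennreal ((2 ^ DIM('a) * A) powr \<eta>) +
          (\<integral>\<^sup>+ j. ennreal (c j) * mass \<Phi> (tcube j z) \<partial>count_space {..<k})"
          unfolding c_def M_def
          by (rule frac_max_ennpowr_le) (use assms \<eta>' A le True in auto)
        then show ?thesis using True by simp
      qed simp
    qed
    also have "\<dots> = ennreal ((2 ^ DIM('a) * A) powr \<eta>) * emeasure lborel (tcube k x) +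
        (\<integral>\<^sup>+ z. (\<integral>\<^sup>+ j. ennreal (c j) * (mass \<Phi> (tcube j z) * indicator (tcube k x) z) \<partial>count_space {..<k}) \<partial>lborel)"
    proof (subst nn_integral_add)
      show "(\<lambda>z. \<integral>\<^sup>+ j. ennreal (c j) * (mass \<Phi> (tcube j z) * indicator (tcube k x) z) \<partial>count_space {..<k}) \<in> borel_measurable lborel"
        by (intro borel_measurable_nn_integral_count_space) auto
    qed (simp_all add: nn_integral_cmult_indicator)
    also have "(\<integral>\<^sup>+ z. (\<integral>\<^sup>+ j. ennreal (c j) * (mass \<Phi> (tcube j z) * indicator (tcube k x) z) \<partial>count_space {..<k}) \<partial>lborel)
      = (\<integral>\<^sup>+ j. (\<integral>\<^sup>+ z. ennreal (c j) * (mass \<Phi> (tcube j z) * indicator (tcube k x) z) \<partial>lborel) \<partial>count_space {..<k})"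
      by (rule nn_integral_count_space_nn_integral) auto
    also have "\<dots> = (\<integral>\<^sup>+ j. ennreal (c j) * (\<integral>\<^sup>+ z. mass \<Phi> (tcube j z) * indicator (tcube k x) z \<partial>lborel) \<partial>count_space {..<k})"
      by (intro nn_integral_cong nn_integral_cmult) simp
    also have "\<dots> \<le> (\<integral>\<^sup>+ j. ennreal (3 ^ DIM('a) * A powr (\<eta> - \<eta>') * M powr \<eta>') * ennreal (side j powr e) \<partial>count_space {..<k})"
    proof (rule nn_integral_mono)
      fix j assume "j \<in> space (count_space {..<k})"
      then have jk: "j \<le> k" by simp
      have "(\<integral>\<^sup>+ z. mass \<Phi> (tcube j z) * indicator (tcube k x) z \<partial>lborel)
        \<le> ennreal (3 ^ DIM('a) * side j powr ?n) * mass \<Phi> (tcube (k + 1) x)"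
        by (rule nn_integral_mass_tcube_le[OF \<Phi> jk])
      also have "\<dots> \<le> ennreal (3 ^ DIM('a) * side j powr ?n) * ennreal M"
        unfolding M_def using le by (intro mult_left_mono) auto
      finally have "ennreal (c j) * (\<integral>\<^sup>+ z. mass \<Phi> (tcube j z) * indicator (tcube k x) z \<partial>lborel)
        \<le> ennreal (c j) * (ennreal (3 ^ DIM('a) * side j powr ?n) * ennreal M)"
        by (rule mult_left_mono) simp
      also have "\<dots> = ennreal (c j * (3 ^ DIM('a) * side j powr ?n * M))"
        using cpos[of j] M by (simp add: ennreal_mult[symmetric])
      also have "c j * (3 ^ DIM('a) * side j powr ?n * M)
        = 3 ^ DIM('a) * A powr (\<eta> - \<eta>') * (M powr (\<eta>' - 1) * M powr 1) * (side j powr ((\<beta> - ?n) * \<eta>') * side j powr ?n)"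
        unfolding c_def using M by (simp add: mult_ac)
      also have "\<dots> = 3 ^ DIM('a) * A powr (\<eta> - \<eta>') * M powr \<eta>' * side j powr e"
        unfolding powr_add[symmetric] e_def by (simp add: algebra_simps)
      finally show "ennreal (c j) * (\<integral>\<^sup>+ z. mass \<Phi> (tcube j z) * indicator (tcube k x) z \<partial>lborel)
        \<le> ennreal (3 ^ DIM('a) * A powr (\<eta> - \<eta>') * M powr \<eta>') * ennreal (side j powr e)"
        by (simp add: ennreal_mult)
    qed
    also have "\<dots> = ennreal (3 ^ DIM('a) * A powr (\<eta> - \<eta>') * M powr \<eta>') * (\<integral>\<^sup>+ j. ennreal (side j powr e) \<partial>count_space {..<k})"
      by (simp add: nn_integral_cmult)
    also have "\<dots> \<le> ennreal (3 ^ DIM('a) * A powr (\<eta> - \<eta>') * M powr \<eta>') * ennreal (side k powr e / (1 - 2 powr (-e)))"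
    proof (intro mult_left_mono nn_integral_count_space_le)
      fix F assume "finite F" "F \<subseteq> {..<k}"
      then have "(\<Sum>j\<in>F. side j powr e) \<le> side k powr e / (1 - 2 powr (-e))"
        by (intro sum_side_powr_le e) (simp_all add: subset_eq side_mono less_imp_le)
      then show "(\<Sum>j\<in>F. ennreal (side j powr e)) \<le> ennreal (side k powr e / (1 - 2 powr (-e)))"
        by (simp add: ennreal_leI)
    qed auto
    also have "\<dots> = ennreal (3 ^ DIM('a) * A powr (\<eta> - \<eta>') * M powr \<eta>' * (side k powr e / (1 - 2 powr (-e))))"
      using A e' by (simp add: ennreal_mult[symmetric])
    also have "3 ^ DIM('a) * A powr (\<eta> - \<eta>') * M powr \<eta>' * (side k powr e / (1 - 2 powr (-e)))
      = 3 ^ DIM('a) * K * side k powr ?n * A powr \<eta>"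
    proof -
      have "M powr \<eta>' = A powr \<eta>' * (2 powr ((?n - \<beta>) * \<eta>') * side k powr ((?n - \<beta>) * \<eta>'))"
        unfolding M_def using A by (simp add: side_add_1 powr_mult powr_powr)
      then have "3 ^ DIM('a) * A powr (\<eta> - \<eta>') * M powr \<eta>' * (side k powr e / (1 - 2 powr (-e)))
        = 3 ^ DIM('a) * K * (side k powr ((?n - \<beta>) * \<eta>') * side k powr e) * (A powr (\<eta> - \<eta>') * A powr \<eta>')"
        unfolding K_def by (simp add: mult_ac)
      also have "\<dots> = 3 ^ DIM('a) * K * side k powr ?n * A powr \<eta>"
        unfolding powr_add[symmetric] e_def by simp
      finally show ?thesis .
    qed
    finally have "(\<integral>\<^sup>+ z. frac_max \<beta> \<Phi> z ennpowr \<eta> * indicator (tcube k x) z \<partial>lborel)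
      \<le> ennreal ((2 ^ DIM('a) * A) powr \<eta>) * emeasure lborel (tcube k x) + ennreal (3 ^ DIM('a) * K * side k powr ?n * A powr \<eta>)"
      by (simp add: add_left_mono)
    also have "\<dots> \<le> ennreal ((2 ^ DIM('a) * A) powr \<eta>) * ennreal (3 ^ DIM('a) * side k powr ?n) + ennreal (3 ^ DIM('a) * K * side k powr ?n * A powr \<eta>)"
      by (intro add_right_mono mult_left_mono emeasure_tcube_le) simp
    also have "\<dots> = ennreal (C * side k powr ?n * A powr \<eta>)"
      unfolding C_def using A K by (simp add: ennreal_mult[symmetric] powr_mult algebra_simps flip: ennreal_plus)
    finally show "(\<integral>\<^sup>+ z. frac_max \<beta> \<Phi> z ennpowr \<eta> * indicator (tcube k x) z \<partial>lborel)
      \<le> ennreal (C * side k powr ?n * A powr \<eta>)" .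
  qed
qed

section \<open>Pointwise bounds for the Havin--Maz'ya potential\<close>

lemma min_le_geometric_mean:
  fixes a b \<theta> :: real
  assumes "0 < a" "0 < b" "0 \<le> \<theta>" "\<theta> \<le> 1"
  shows "min a b \<le> a powr \<theta> * b powr (1 - \<theta>)"
proof -
  have "min a b = min a b powr \<theta> * min a b powr (1 - \<theta>)"
    using assms by (simp add: powr_add[symmetric])
  also have "\<dots> \<le> a powr \<theta> * b powr (1 - \<theta>)"
    using assms by (intro mult_mono powr_mono2) auto
  finally show ?thesis .
qed

text \<open>The minimum in \<open>mass_tcube_le_min\<close> is at most any weighted geometric mean
  of its entries, and one weight turns the growth of order \<open>\<kappa> * q\<close> into that of
  order \<open>\<kappa>' * q\<close>.\<close>

lemma frac_max_interpolate:
  fixes \<kappa> \<kappa>' q \<tau> :: real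
  assumes "\<kappa> \<le> \<kappa>'" "\<kappa>' * (q * \<tau>) < real DIM('a)" "0 < q" "1 < \<tau>"
  shows "\<exists>C>0. \<forall>(\<Phi> :: 'a::euclidean_space \<Rightarrow> real) x A. \<Phi> \<in> borel_measurable borel \<longrightarrow> (\<forall>y. 0 \<le> \<Phi> y) \<longrightarrow>
    (\<integral>\<^sup>+ y. ennreal (\<Phi> y powr \<tau>) \<partial>lborel) \<le> 1 \<longrightarrow> 0 < A \<longrightarrow> frac_max (\<kappa> * q) \<Phi> x \<le> ennreal A \<longrightarrow>
    frac_max (\<kappa>' * q) \<Phi> x
      \<le> ennreal (C * A powr ((real DIM('a) / (q * \<tau>) - \<kappa>') / (real DIM('a) / (q * \<tau>) - \<kappa>)))"
proof -
  let ?n = "real DIM('a)"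
  define d where "d = ?n / (q * \<tau>)"
  have "\<kappa>' < d" unfolding d_def using assms by (simp add: pos_less_divide_eq)
  then have d: "0 < d - \<kappa>" "0 < d - \<kappa>'" using assms(1) by auto
  \<comment> \<open>The weight for which the power of the side contributed by the second entry is
    exactly \<open>(\<kappa> - \<kappa>') * q\<close>.\<close>
  define \<theta> where "\<theta> = (d - \<kappa>') / (d - \<kappa>)"
  have \<theta>: "0 \<le> \<theta>" "\<theta> \<le> 1" unfolding \<theta>_def using d assms(1) by simp_all
  define K :: real where "K = 3 ^ DIM('a) + 1"
  have K: "K > 0" unfolding K_def by (simp add: add_pos_pos)
  show ?thesis
  proof (intro exI[of _ "K powr (1 - \<theta>)"] conjI allI impI)
    show "K powr (1 - \<theta>) > 0" using K by simp
  next
    fix \<Phi> :: "'a \<Rightarrow> real" and x and A :: real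
    assume \<Phi>: "\<Phi> \<in> borel_measurable borel" "\<forall>y. 0 \<le> \<Phi> y"
      and int: "(\<integral>\<^sup>+ y. ennreal (\<Phi> y powr \<tau>) \<partial>lborel) \<le> 1"
      and A: "0 < A" "frac_max (\<kappa> * q) \<Phi> x \<le> ennreal A"
    have "mass \<Phi> (tcube k x) \<le> ennreal (K powr (1 - \<theta>) * A powr \<theta> * side k powr (?n - \<kappa>' * q))" for k
    proof -
      have "mass \<Phi> (tcube k x) \<le> ennreal (side k powr (?n - \<kappa> * q) * min A (K * side k powr (\<kappa> * q - ?n / \<tau>)))"
        unfolding K_def by (rule mass_tcube_le_min) (use \<Phi> assms(4) int A in auto)
      also have "\<dots> \<le> ennreal (side k powr (?n - \<kappa> * q) * (A powr \<theta> * (K * side k powr (\<kappa> * q - ?n / \<tau>)) powr (1 - \<theta>)))"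
        using A K \<theta> by (intro ennreal_leI mult_left_mono min_le_geometric_mean) auto
      also have "(K * side k powr (\<kappa> * q - ?n / \<tau>)) powr (1 - \<theta>) = K powr (1 - \<theta>) * side k powr ((\<kappa> - \<kappa>') * q)"
      proof -
        have e1: "1 - \<theta> = (\<kappa>' - \<kappa>) / (d - \<kappa>)" unfolding \<theta>_def using d by (simp add: field_simps)
        have e2: "\<kappa> * q - ?n / \<tau> = - q * (d - \<kappa>)" unfolding d_def using assms(3,4) by (simp add: field_simps)
        have "(\<kappa> * q - ?n / \<tau>) * (1 - \<theta>) = - q * (\<kappa>' - \<kappa>)" unfolding e1 e2 using d by simp
        then have "(\<kappa> * q - ?n / \<tau>) * (1 - \<theta>) = (\<kappa> - \<kappa>') * q" by (simp add: algebra_simps)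
        then show ?thesis using K by (simp add: powr_mult powr_powr)
      qed
      also have "side k powr (?n - \<kappa> * q) * (A powr \<theta> * (K powr (1 - \<theta>) * side k powr ((\<kappa> - \<kappa>') * q)))
        = K powr (1 - \<theta>) * A powr \<theta> * (side k powr (?n - \<kappa> * q) * side k powr ((\<kappa> - \<kappa>') * q))"
        by (simp only: mult_ac)
      also have "side k powr (?n - \<kappa> * q) * side k powr ((\<kappa> - \<kappa>') * q) = side k powr (?n - \<kappa>' * q)"
        unfolding powr_add[symmetric] by (simp add: algebra_simps)
      finally show ?thesis .
    qed
    then have "frac_max (\<kappa>' * q) \<Phi> x \<le> ennreal (K powr (1 - \<theta>) * A powr \<theta>)"
      by (subst frac_max_le_iff) auto
    then show "frac_max (\<kappa>' * q) \<Phi> x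
      \<le> ennreal (K powr (1 - \<theta>) * A powr ((?n / (q * \<tau>) - \<kappa>') / (?n / (q * \<tau>) - \<kappa>)))"
      unfolding \<theta>_def d_def .
  qed
qed

text \<open>Again \<open>q * \<tau>\<close> is the Lebesgue exponent. The number
  \<open>\<eta>\<close> is \<open>m\<close> times the exponent in the bound for the inner potential,
  \<open>A1\<close> is the averaging condition for it, and \<open>sub\<close> amounts to convergence
  of the outer sum at large scales.\<close>

lemma iterated_riesz_potential_le_frac_max:
  fixes \<alpha> \<kappa> q \<tau> m \<eta> :: real
  assumes "0 < \<kappa>" "\<kappa> < \<alpha>" "\<alpha> < real DIM('a)" "1 < q" "1 < \<tau>" "0 < m"
    and sub: "\<alpha> * (1 + 1 / m) < real DIM('a) / (q * \<tau>)"
  defines "\<eta> \<equiv> m / q * ((real DIM('a) / (q * \<tau>) - \<alpha>) / (real DIM('a) / (q * \<tau>) - \<kappa>))"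
  assumes A1: "(real DIM('a) - \<kappa> * q) * \<eta> < real DIM('a)"
  shows "\<exists>C>0. \<forall>(h :: 'a::euclidean_space \<Rightarrow> real) x A. h \<in> borel_measurable borel \<longrightarrow> (\<forall>y. 0 \<le> h y) \<longrightarrow>
    (\<integral>\<^sup>+ y. ennreal (h y powr (q * \<tau>)) \<partial>lborel) \<le> 1 \<longrightarrow> 0 < A \<longrightarrow>
    frac_max (\<kappa> * q) (\<lambda>y. h y powr q) x \<le> ennreal A \<longrightarrow>
    riesz_potential \<alpha> (\<lambda>z. riesz_potential \<alpha> (\<lambda>y. ennreal (h y)) z ennpowr m) x
      \<le> ennreal (C * A powr (\<eta> - \<alpha> / (q * (real DIM('a) / (q * \<tau>) - \<kappa>))))"
proof -
  let ?n = "real DIM('a)"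
  define d where "d = ?n / (q * \<tau>)"
  have \<alpha>: "\<alpha> > 0" using assms(1,2) by simp
  have "\<alpha> * 1 \<le> \<alpha> * (1 + 1 / m)" using \<alpha> assms(6) by (intro mult_left_mono) auto
  then have \<alpha>d: "\<alpha> < d" using sub unfolding d_def by linarith
  then have \<kappa>d: "\<kappa> < d" using assms(2) by simp
  have qt: "1 < q * \<tau>" using assms(4,5) by (simp add: less_1_mult)
  have \<alpha>q: "\<alpha> * (q * \<tau>) < ?n" using \<alpha>d qt unfolding d_def by (simp add: pos_less_divide_eq)
  have \<kappa>q: "\<kappa> * q < ?n"
  proof -
    have "\<kappa> * q \<le> \<alpha> * (q * \<tau>)" using assms(1-5) by (intro mult_mono) auto
    then show ?thesis using \<alpha>q by simp
  qed
  have \<eta>_eq: "\<eta> = m * (1 / q * (1 - (\<alpha> - \<kappa>) / (d - \<kappa>)))"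
    unfolding \<eta>_def d_def[symmetric] using \<kappa>d by (simp add: diff_divide_eq_iff)
  have \<eta>: "\<eta> > 0" unfolding \<eta>_def d_def[symmetric] using \<alpha>d \<kappa>d assms(4,6) by simp
  \<comment> \<open>The decay rate, in powers of the side, of the averages of the majorant
    \<open>w\<close> introduced below.\<close>
  define b where "b = (?n / \<tau> - \<kappa> * q) * \<eta>"
  have n\<tau>: "?n / \<tau> - \<kappa> * q = q * (d - \<kappa>)" unfolding d_def using assms(4,5) by (simp add: field_simps)
  have b_eq: "b = m * (d - \<alpha>)"
    unfolding b_def n\<tau> \<eta>_def d_def[symmetric] using \<kappa>d assms(4) by simp
  have b: "\<alpha> - 0 < b"
  proof -
    have "m * (\<alpha> * (1 + 1 / m)) < m * d" using sub assms(6) unfolding d_def by (intro mult_strict_left_mono)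
    then show ?thesis unfolding b_eq using assms(6) by (simp add: algebra_simps)
  qed
  have e_eq: "\<eta> * (1 - (\<alpha> - 0) / b) = \<eta> - \<alpha> / (q * (d - \<kappa>))"
    unfolding b_def n\<tau> using \<eta> by (simp add: right_diff_distrib)
  define K :: real where "K = 3 ^ DIM('a) + 1"
  have K: "K \<ge> 1" by (simp add: K_def)
  obtain C1 where C1: "C1 > 0" and C1_le: "\<forall>(h :: 'a \<Rightarrow> real) x A. h \<in> borel_measurable borel \<longrightarrow> (\<forall>y. 0 \<le> h y) \<longrightarrow>
    (\<integral>\<^sup>+ y. ennreal (h y powr (q * \<tau>)) \<partial>lborel) \<le> 1 \<longrightarrow> 0 < A \<longrightarrow>
    frac_max (\<kappa> * q) (\<lambda>y. h y powr q) x \<le> ennreal A \<longrightarrow>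
    riesz_potential \<alpha> (\<lambda>y. ennreal (h y)) x \<le> ennreal (C1 * A powr (1 / q * (1 - (\<alpha> - \<kappa>) / (d - \<kappa>))))"
    using riesz_potential_le_frac_max[OF \<alpha> assms(2-5) \<alpha>q] unfolding d_def by blast
  obtain C2 where C2: "C2 > 0" and C2_le: "\<forall>(\<Phi> :: 'a \<Rightarrow> real) x k A. \<Phi> \<in> borel_measurable borel \<longrightarrow> 0 < A \<longrightarrow>
    (\<forall>j\<ge>k. mass \<Phi> (tcube j x) \<le> ennreal (A * side j powr (?n - \<kappa> * q))) \<longrightarrow>
    (\<integral>\<^sup>+ z. frac_max (\<kappa> * q) \<Phi> z ennpowr \<eta> * indicator (tcube k x) z \<partial>lborel)
      \<le> ennreal (C2 * side k powr ?n * A powr \<eta>)"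
    using nn_integral_frac_max_ennpowr_le[of "\<kappa> * q" \<eta>, OF _ \<kappa>q \<eta> A1] assms(1,4) by auto
  obtain C3 where C3: "C3 > 0" and C3_le: "\<forall>(g :: 'a \<Rightarrow> ennreal) x X D. g \<in> borel_measurable borel \<longrightarrow> 0 < X \<longrightarrow> 0 \<le> D \<longrightarrow>
    (\<forall>k. (\<integral>\<^sup>+ y. g y * indicator (tcube k x) y \<partial>lborel)
       \<le> ennreal (D * side k powr (?n - 0) * min X (side k powr (-b)))) \<longrightarrow>
    riesz_potential \<alpha> g x \<le> ennreal (C3 * D * X powr (1 - (\<alpha> - 0) / b))"
    using riesz_potential_le_of_tcube_bounds[OF \<alpha> assms(3) b] by blast
  define D where "D = C1 powr m * C2 * K powr \<eta>"
  have D: "D > 0" unfolding D_def using C1 C2 K by simp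
  show ?thesis
  proof (intro exI[of _ "C3 * D"] conjI allI impI)
    show "C3 * D > 0" using C3 D by simp
  next
    fix h :: "'a \<Rightarrow> real" and x and A :: real
    assume h[measurable]: "h \<in> borel_measurable borel" and nn: "\<forall>y. 0 \<le> h y"
      and int: "(\<integral>\<^sup>+ y. ennreal (h y powr (q * \<tau>)) \<partial>lborel) \<le> 1" and A: "0 < A"
      and G: "frac_max (\<kappa> * q) (\<lambda>y. h y powr q) x \<le> ennreal A"
    define \<Phi> where "\<Phi> = (\<lambda>y. h y powr q)"
    have \<Phi>[measurable]: "\<Phi> \<in> borel_measurable borel" unfolding \<Phi>_def by measurable
    define w where "w z = ennreal (C1 powr m) * frac_max (\<kappa> * q) \<Phi> z ennpowr \<eta>" for z
    have w[measurable]: "w \<in> borel_measurable borel" unfolding w_def[abs_def] by measurable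
    have uw: "riesz_potential \<alpha> (\<lambda>y. ennreal (h y)) z ennpowr m \<le> w z" for z
      unfolding w_def
    proof (rule le_ennpowrI)
      fix B assume B: "0 < B" "frac_max (\<kappa> * q) \<Phi> z \<le> ennreal B"
      have "riesz_potential \<alpha> (\<lambda>y. ennreal (h y)) z \<le> ennreal (C1 * B powr (1 / q * (1 - (\<alpha> - \<kappa>) / (d - \<kappa>))))"
        using C1_le h nn int B unfolding \<Phi>_def by blast
      then have "riesz_potential \<alpha> (\<lambda>y. ennreal (h y)) z ennpowr m
        \<le> ennreal (C1 * B powr (1 / q * (1 - (\<alpha> - \<kappa>) / (d - \<kappa>)))) ennpowr m"
        by (rule ennpowr_mono) (rule assms(6))
      also have "\<dots> = ennreal (C1 powr m * B powr \<eta>)"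
        unfolding \<eta>_eq using C1 B by (simp add: ennpowr_ennreal powr_mult powr_powr mult.commute)
      finally show "riesz_potential \<alpha> (\<lambda>y. ennreal (h y)) z ennpowr m \<le> ennreal (C1 powr m * B powr \<eta>)" .
    qed (use C1 \<eta> in auto)
    have "(\<integral>\<^sup>+ y. w y * indicator (tcube k x) y \<partial>lborel)
       \<le> ennreal (D * side k powr (?n - 0) * min (A powr \<eta>) (side k powr (-b)))" for k
    proof -
      \<comment> \<open>A bound depending on the scale \<open>k\<close>: its second entry decreases
        in the scale, so its value at \<open>k\<close> serves all larger triples about
        \<open>x\<close> at once.\<close>
      define a where "a = min A (K * side k powr (\<kappa> * q - ?n / \<tau>))"
      have a: "a > 0" unfolding a_def using A K by simp
      have le: "mass \<Phi> (tcube j x) \<le> ennreal (a * side j powr (?n - \<kappa> * q))" if "k \<le> j" for j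
      proof -
        have "mass \<Phi> (tcube j x) \<le> ennreal (side j powr (?n - \<kappa> * q) * min A (K * side j powr (\<kappa> * q - ?n / \<tau>)))"
          unfolding K_def by (rule mass_tcube_le_min) (use \<Phi> nn assms(5) int A G in \<open>simp_all add: \<Phi>_def powr_powr\<close>)
        also have "\<dots> \<le> ennreal (side j powr (?n - \<kappa> * q) * a)"
        proof (intro ennreal_leI mult_left_mono)
          have "side j powr (\<kappa> * q - ?n / \<tau>) \<le> side k powr (\<kappa> * q - ?n / \<tau>)"
            using n\<tau> \<kappa>d assms(4) that by (intro powr_mono2') (simp_all add: side_mono algebra_simps)
          then have "K * side j powr (\<kappa> * q - ?n / \<tau>) \<le> K * side k powr (\<kappa> * q - ?n / \<tau>)"
            using K by (intro mult_left_mono) auto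
          then show "min A (K * side j powr (\<kappa> * q - ?n / \<tau>)) \<le> a" unfolding a_def by auto
        qed simp
        finally show ?thesis by (simp add: mult.commute)
      qed
      have "(\<integral>\<^sup>+ y. w y * indicator (tcube k x) y \<partial>lborel)
        = ennreal (C1 powr m) * (\<integral>\<^sup>+ z. frac_max (\<kappa> * q) \<Phi> z ennpowr \<eta> * indicator (tcube k x) z \<partial>lborel)"
        unfolding w_def by (simp add: nn_integral_cmult mult.assoc)
      also have "\<dots> \<le> ennreal (C1 powr m) * ennreal (C2 * side k powr ?n * a powr \<eta>)"
        using C2_le \<Phi> a le by (intro mult_left_mono) auto
      also have "\<dots> = ennreal (C1 powr m * C2 * side k powr ?n * a powr \<eta>)"
        using C2 by (simp add: ennreal_mult[symmetric] mult.assoc)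
      also have "\<dots> \<le> ennreal (D * side k powr (?n - 0) * min (A powr \<eta>) (side k powr (-b)))"
      proof (rule ennreal_leI)
        have 1: "a powr \<eta> \<le> K powr \<eta> * side k powr (-b)"
        proof -
          have "a powr \<eta> \<le> (K * side k powr (\<kappa> * q - ?n / \<tau>)) powr \<eta>"
            using a \<eta> by (intro powr_mono2) (auto simp: a_def)
          also have "\<dots> = K powr \<eta> * side k powr (-b)"
            unfolding b_def using K by (simp add: powr_mult powr_powr algebra_simps)
          finally show ?thesis .
        qed
        have 2: "a powr \<eta> \<le> K powr \<eta> * A powr \<eta>"
        proof -
          have "a powr \<eta> \<le> 1 * A powr \<eta>" using a \<eta> by (auto simp: a_def intro!: powr_mono2)
          also have "\<dots> \<le> K powr \<eta> * A powr \<eta>"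
            using K \<eta> by (intro mult_right_mono ge_one_powr_ge_zero) auto
          finally show ?thesis .
        qed
        have "a powr \<eta> \<le> K powr \<eta> * min (A powr \<eta>) (side k powr (-b))" using 1 2 by (simp add: min_def)
        then have "C1 powr m * C2 * side k powr ?n * a powr \<eta>
          \<le> C1 powr m * C2 * side k powr ?n * (K powr \<eta> * min (A powr \<eta>) (side k powr (-b)))"
          using C2 by (intro mult_left_mono) auto
        then show "C1 powr m * C2 * side k powr ?n * a powr \<eta> \<le> D * side k powr (?n - 0) * min (A powr \<eta>) (side k powr (-b))"
          unfolding D_def by (simp add: mult_ac)
      qed
      finally show ?thesis .
    qed
    then have "riesz_potential \<alpha> w x \<le> ennreal (C3 * D * (A powr \<eta>) powr (1 - (\<alpha> - 0) / b))"
      using C3_le w A D by simp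
    also have "(A powr \<eta>) powr (1 - (\<alpha> - 0) / b) = A powr (\<eta> - \<alpha> / (q * (d - \<kappa>)))"
      unfolding powr_powr e_eq ..
    finally show "riesz_potential \<alpha> (\<lambda>z. riesz_potential \<alpha> (\<lambda>y. ennreal (h y)) z ennpowr m) x
      \<le> ennreal (C3 * D * A powr (\<eta> - \<alpha> / (q * (?n / (q * \<tau>) - \<kappa>))))"
      unfolding d_def[symmetric] using riesz_potential_mono[OF uw] by (rule order_trans[rotated])
  qed
qed

section \<open>Homogeneity and insensitivity to null sets\<close>

lemma riesz_potential_cmult:
  fixes g :: "'a::euclidean_space \<Rightarrow> ennreal"
  assumes [measurable]: "g \<in> borel_measurable borel"
  shows "riesz_potential \<alpha> (\<lambda>y. c * g y) x = c * riesz_potential \<alpha> g x"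
  unfolding riesz_potential_def
  by (simp add: nn_integral_completion ennreal_times_divide[symmetric] nn_integral_cmult)

lemma riesz_potential_measurable [measurable]:
  fixes g :: "'a::euclidean_space \<Rightarrow> ennreal"
  assumes [measurable]: "g \<in> borel_measurable borel"
  shows "riesz_potential \<alpha> g \<in> borel_measurable borel"
  unfolding riesz_potential_def[abs_def] nn_integral_completion
  by (rule lborel.borel_measurable_nn_integral) simp

lemma havin_mazya_potential_cong_AE:
  assumes "AE y in lborel. f y = g y"
  shows "havin_mazya_potential \<alpha> p f = havin_mazya_potential \<alpha> p g"
proof -
  have "riesz_potential \<alpha> (\<lambda>y. ennreal \<bar>f y\<bar>) x = riesz_potential \<alpha> (\<lambda>y. ennreal \<bar>g y\<bar>) x" for x
    unfolding riesz_potential_def nn_integral_completion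
    by (rule nn_integral_cong_AE) (use assms in eventually_elim, simp)
  then show ?thesis unfolding havin_mazya_potential_def by simp
qed

text \<open>Both Riesz integrals are homogeneous of degree one; only the inner one sits under the
  power, hence the degree \<open>1 / (p - 1)\<close>.\<close>

lemma havin_mazya_potential_scale:
  fixes g :: "'a::euclidean_space \<Rightarrow> real"
  assumes [measurable]: "g \<in> borel_measurable borel" and "0 < c" "1 < p"
  shows "havin_mazya_potential \<alpha> p (\<lambda>y. c * g y) x = ennreal (c powr (1 / (p - 1))) * havin_mazya_potential \<alpha> p g x"
proof -
  have "riesz_potential \<alpha> (\<lambda>y. ennreal \<bar>c * g y\<bar>) z ennpowr (1 / (p - 1))
    = ennreal (c powr (1 / (p - 1))) * riesz_potential \<alpha> (\<lambda>y. ennreal \<bar>g y\<bar>) z ennpowr (1 / (p - 1))" for z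
    using assms by (simp add: abs_mult ennreal_mult riesz_potential_cmult ennpowr_mult_ennreal)
  then show ?thesis unfolding havin_mazya_potential_def by (simp add: riesz_potential_cmult)
qed

text \<open>In terms of \<open>y = n / r\<close> the condition is affine. It holds strictly at
  \<open>y = n / q\<close>, so it persists for some slightly larger \<open>y\<close>, that is, for
  some \<open>r\<close> below \<open>q\<close>.\<close>

lemma exists_subexponent:
  fixes n c q B :: real
  assumes "0 < n" "1 < q" "0 < c" "c < n / q" "0 < B" "(n / q - c) * B < n / q * q"
  shows "\<exists>r>1. r < q \<and> (n / r - c) * B < n"
proof -
  have "n / q < min n (c + n / B)"
    using assms by (simp add: field_simps)
  then obtain y where y: "n / q < y" "y < min n (c + n / B)" using dense by blast
  have "0 < n / q" using assms by simp
  then have "0 < y" using y by linarith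
  have "1 < n / y" "n / y < q" "(n / (n / y) - c) * B < n"
    using y \<open>0 < y\<close> assms by (simp_all add: field_simps)
  then show ?thesis by blast
qed

lemma havin_mazya_potential_le_frac_max:
  fixes \<alpha> \<kappa> p q :: real
  assumes "0 < \<alpha>" "\<alpha> < real DIM('a)" "0 \<le> \<kappa>" "\<kappa> < \<alpha>" "1 < q" "1 < p"
    and pq: "1 + 1 / q - \<alpha> / real DIM('a) < p" and apq: "\<alpha> * p * q < real DIM('a)"
  shows "\<exists>r>1. r < q \<and> (\<exists>C>0. \<forall>(h :: 'a::euclidean_space \<Rightarrow> real) x A. h \<in> borel_measurable borel \<longrightarrow> (\<forall>y. 0 \<le> h y) \<longrightarrow>
    (\<integral>\<^sup>+ y. ennreal (h y powr q) \<partial>lborel) \<le> 1 \<longrightarrow> 0 < A \<longrightarrow>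
    frac_max (\<kappa> * r) (\<lambda>y. h y powr r) x \<le> ennreal A \<longrightarrow>
    havin_mazya_potential \<alpha> p h x
      \<le> ennreal (C * A powr ((real DIM('a) / q - \<alpha> * p) / ((p - 1) * r * (real DIM('a) / q - \<kappa>)))))"
proof -
  let ?n = "real DIM('a)"
  define m where "m = 1 / (p - 1)"
  have m: "m > 0" unfolding m_def using assms by simp
  define d where "d = ?n / q"
  have apd: "\<alpha> * p < d" unfolding d_def using apq assms(5) by (simp add: pos_less_divide_eq)
  have "\<alpha> * 1 < \<alpha> * p" using assms by (intro mult_strict_left_mono) auto
  then have ad: "\<alpha> < d" using apd by simp
  obtain \<kappa>' where \<kappa>': "\<kappa> < \<kappa>'" "\<kappa>' < \<alpha>" using dense[OF assms(4)] by blast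
  have \<kappa>'pos: "0 < \<kappa>'" using \<kappa>' assms by simp
  have \<kappa>d: "\<kappa>' < d" "\<kappa> < d" using \<kappa>' ad by auto
  \<comment> \<open>The hypothesis on \<open>p\<close> in the form needed for
    \<open>exists_subexponent\<close>: at \<open>r = q\<close> the factor
    \<open>d - \<kappa>'\<close> cancels and the averaging condition becomes this
    inequality.\<close>
  have md: "m * (d - \<alpha>) < ?n"
  proof -
    have "?n * (1 / q - \<alpha> / ?n) < ?n * (p - 1)" using pq by (intro mult_strict_left_mono) auto
    then have "d - \<alpha> < ?n * (p - 1)" unfolding d_def by (simp add: algebra_simps)
    then show ?thesis unfolding m_def using assms(6) by (simp add: field_simps)
  qed
  obtain r where r: "1 < r" "r < q" "(?n / r - \<kappa>') * (m * ((d - \<alpha>) / (d - \<kappa>'))) < ?n"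
    using exists_subexponent[of ?n q \<kappa>' "m * ((d - \<alpha>) / (d - \<kappa>'))"] assms \<kappa>'pos \<kappa>d m ad md
    by (auto simp: d_def)
  define \<tau> where "\<tau> = q / r"
  have \<tau>: "1 < \<tau>" "r * \<tau> = q" unfolding \<tau>_def using r by auto
  define \<eta> where "\<eta> = m / r * ((d - \<alpha>) / (d - \<kappa>'))"
  have A1: "(?n - \<kappa>' * r) * \<eta> < ?n"
  proof -
    have "(?n - \<kappa>' * r) * \<eta> = (?n / r - \<kappa>') * (m * ((d - \<alpha>) / (d - \<kappa>')))"
      unfolding \<eta>_def using r(1) by (simp add: field_simps)
    then show ?thesis using r(3) by simp
  qed
  \<comment> \<open>Since \<open>1 + 1 / m\<close> equals \<open>p\<close>, this is
    \<open>\<alpha> * p < d\<close>.\<close>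
  have sub: "\<alpha> * (1 + 1 / m) < ?n / (r * \<tau>)" unfolding \<tau> using apd by (simp add: m_def d_def)
  obtain C1 where C1: "C1 > 0" and C1_le: "\<forall>(h :: 'a \<Rightarrow> real) x A. h \<in> borel_measurable borel \<longrightarrow> (\<forall>y. 0 \<le> h y) \<longrightarrow>
    (\<integral>\<^sup>+ y. ennreal (h y powr q) \<partial>lborel) \<le> 1 \<longrightarrow> 0 < A \<longrightarrow>
    frac_max (\<kappa>' * r) (\<lambda>y. h y powr r) x \<le> ennreal A \<longrightarrow>
    riesz_potential \<alpha> (\<lambda>z. riesz_potential \<alpha> (\<lambda>y. ennreal (h y)) z ennpowr m) x
      \<le> ennreal (C1 * A powr (\<eta> - \<alpha> / (r * (d - \<kappa>'))))"
    using iterated_riesz_potential_le_frac_max[OF \<kappa>'pos \<kappa>'(2) assms(2) r(1) \<tau>(1) m sub] A1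
    unfolding \<tau> d_def[symmetric] \<eta>_def[symmetric] by blast
  have "\<kappa>' * (r * \<tau>) < ?n" unfolding \<tau> using \<kappa>d(1) assms(5) by (simp add: d_def pos_less_divide_eq)
  then obtain C2 where C2: "C2 > 0" and C2_le: "\<forall>(\<Phi> :: 'a \<Rightarrow> real) x A. \<Phi> \<in> borel_measurable borel \<longrightarrow> (\<forall>y. 0 \<le> \<Phi> y) \<longrightarrow>
    (\<integral>\<^sup>+ y. ennreal (\<Phi> y powr \<tau>) \<partial>lborel) \<le> 1 \<longrightarrow> 0 < A \<longrightarrow> frac_max (\<kappa> * r) \<Phi> x \<le> ennreal A \<longrightarrow>
    frac_max (\<kappa>' * r) \<Phi> x \<le> ennreal (C2 * A powr ((d - \<kappa>') / (d - \<kappa>)))"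
    using frac_max_interpolate[of \<kappa> \<kappa>' r \<tau>, where 'a = 'a] \<kappa>'(1) r(1) \<tau>(1)
    unfolding \<tau> d_def[symmetric] by auto
  define e where "e = \<eta> - \<alpha> / (r * (d - \<kappa>'))"
  \<comment> \<open>The auxiliary order \<open>\<kappa>'\<close> cancels from the final
    exponent.\<close>
  have e_eq: "(d - \<kappa>') / (d - \<kappa>) * e = (d - \<alpha> * p) / ((p - 1) * r * (d - \<kappa>))"
  proof -
    have "e = (m * (d - \<alpha>) - \<alpha>) / (r * (d - \<kappa>'))"
    proof -
      have "\<eta> = m * (d - \<alpha>) / (r * (d - \<kappa>'))" unfolding \<eta>_def by simp
      then show ?thesis unfolding e_def by (simp only: diff_divide_distrib)
    qed
    also have "m * (d - \<alpha>) - \<alpha> = (d - \<alpha> * p) / (p - 1)"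
      unfolding m_def using assms(6) by (simp add: field_simps)
    finally show ?thesis using r(1) \<kappa>d assms(6) by (simp add: mult_ac)
  qed
  show ?thesis
  proof (rule exI[of _ r], intro conjI r(1,2), rule exI[of _ "C1 * C2 powr e"], intro conjI allI impI)
    show "C1 * C2 powr e > 0" using C1 C2 by simp
  next
    fix h :: "'a \<Rightarrow> real" and x and A :: real
    assume h: "h \<in> borel_measurable borel" and nn: "\<forall>y. 0 \<le> h y"
      and int: "(\<integral>\<^sup>+ y. ennreal (h y powr q) \<partial>lborel) \<le> 1" and A: "0 < A"
      and G: "frac_max (\<kappa> * r) (\<lambda>y. h y powr r) x \<le> ennreal A"
    have "frac_max (\<kappa>' * r) (\<lambda>y. h y powr r) x \<le> ennreal (C2 * A powr ((d - \<kappa>') / (d - \<kappa>)))"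
      using C2_le h int A G \<tau> by (simp add: powr_powr)
    then have "riesz_potential \<alpha> (\<lambda>z. riesz_potential \<alpha> (\<lambda>y. ennreal (h y)) z ennpowr m) x
      \<le> ennreal (C1 * (C2 * A powr ((d - \<kappa>') / (d - \<kappa>))) powr e)"
      unfolding e_def using C1_le h nn int A C2 by simp
    also have "C1 * (C2 * A powr ((d - \<kappa>') / (d - \<kappa>))) powr e
      = C1 * C2 powr e * A powr ((d - \<alpha> * p) / ((p - 1) * r * (d - \<kappa>)))"
      using C2 by (simp add: powr_mult powr_powr flip: e_eq)
    finally show "havin_mazya_potential \<alpha> p h x
      \<le> ennreal (C1 * C2 powr e * A powr ((?n / q - \<alpha> * p) / ((p - 1) * r * (?n / q - \<kappa>))))"
      unfolding havin_mazya_potential_def m_def d_def using nn by simp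
  qed
qed

text \<open>The factor \<open>l\<close> prepares the removal of the normalisation. It is absorbed by
  the level rescaling in \<open>choquet_frac_max_le\<close>, so that monotonicity of the content
  suffices.\<close>

lemma choquet_norm_havin_mazya_potential_unit_le:
  fixes \<alpha> \<kappa> p q s :: real
  assumes "0 < \<alpha>" "\<alpha> < real DIM('a)" "0 \<le> \<kappa>" "\<kappa> < \<alpha>" "1 < q" "1 < p"
    and pq: "1 + 1 / q - \<alpha> / real DIM('a) < p" and apq: "\<alpha> * p * q < real DIM('a)"
    and s: "s = q * (p - 1) * (real DIM('a) - \<kappa> * q) / (real DIM('a) - \<alpha> * p * q)"
  shows "\<exists>C>0. \<forall>(h :: 'a::euclidean_space \<Rightarrow> real) l. h \<in> borel_measurable borel \<longrightarrow> (\<forall>y. 0 \<le> h y) \<longrightarrow>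
    (\<integral>\<^sup>+ y. ennreal (h y powr q) \<partial>lborel) \<le> 1 \<longrightarrow> 0 < l \<longrightarrow>
    choquet_norm (real DIM('a) - \<kappa> * q) UNIV s (\<lambda>x. ennreal l * havin_mazya_potential \<alpha> p h x) \<le> ennreal (C * l)"
proof -
  let ?n = "real DIM('a)"
  obtain r C1 where r: "1 < r" "r < q" and C1: "C1 > 0"
    and C1_le: "\<forall>(h :: 'a \<Rightarrow> real) x A. h \<in> borel_measurable borel \<longrightarrow> (\<forall>y. 0 \<le> h y) \<longrightarrow>
    (\<integral>\<^sup>+ y. ennreal (h y powr q) \<partial>lborel) \<le> 1 \<longrightarrow> 0 < A \<longrightarrow>
    frac_max (\<kappa> * r) (\<lambda>y. h y powr r) x \<le> ennreal A \<longrightarrow>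
    havin_mazya_potential \<alpha> p h x \<le> ennreal (C1 * A powr ((?n / q - \<alpha> * p) / ((p - 1) * r * (?n / q - \<kappa>))))"
    using havin_mazya_potential_le_frac_max[OF assms(1-8)] by blast
  define \<tau> where "\<tau> = q / r"
  have \<tau>: "1 < \<tau>" "r * \<tau> = q" unfolding \<tau>_def using r by auto
  have kq: "\<kappa> * q < ?n"
  proof -
    have "\<kappa> * q \<le> \<alpha> * q" using assms by (intro mult_right_mono) auto
    also have "\<dots> \<le> \<alpha> * p * q" using assms by simp
    finally show ?thesis using apq by simp
  qed
  have spos: "s > 0" unfolding s using assms kq by simp
  define e where "e = (?n / q - \<alpha> * p) / ((p - 1) * r * (?n / q - \<kappa>))"
  \<comment> \<open>This identity dictates the value of \<open>s\<close>: the power \<open>s\<close>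
    of the pointwise bound must be the power \<open>\<tau>\<close> of the maximal function, whose
    Choquet integral is under control.\<close>
  have es: "e * s = \<tau>"
  proof -
    have "?n / q - \<alpha> * p = (?n - \<alpha> * p * q) / q" "?n / q - \<kappa> = (?n - \<kappa> * q) / q"
      using assms(5) by (simp_all add: field_simps)
    then show ?thesis unfolding e_def s \<tau>_def using assms(5,6) r apq kq by simp
  qed
  have "0 \<le> \<kappa> * r" "\<kappa> * r * \<tau> < ?n" using assms(3) r kq \<tau> by (simp_all add: mult.assoc)
  then obtain C2 where C2: "C2 > 0" and C2_le: "\<forall>(\<Phi> :: 'a \<Rightarrow> real) A. \<Phi> \<in> borel_measurable borel \<longrightarrow> (\<forall>y. 0 \<le> \<Phi> y) \<longrightarrow>
       (\<integral>\<^sup>+ y. ennreal (\<Phi> y powr \<tau>) \<partial>lborel) \<le> 1 \<longrightarrow> 0 < A \<longrightarrow>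
       (\<integral>\<^sup>+ t\<in>{0<..}. hausdorff_content (?n - \<kappa> * q) {x. ennreal ((t / A) powr (1 / \<tau>)) < frac_max (\<kappa> * r) \<Phi> x} \<partial>lborel)
       \<le> ennreal (C2 * A)"
    using choquet_frac_max_le[OF \<tau>(1), of "\<kappa> * r", where 'a = 'a] unfolding mult.assoc \<tau>(2) by blast
  show ?thesis
  proof (intro exI[of _ "C2 powr (1 / s) * C1"] conjI allI impI)
    show "C2 powr (1 / s) * C1 > 0" using C1 C2 by simp
  next
    fix h :: "'a \<Rightarrow> real" and l :: real
    assume h[measurable]: "h \<in> borel_measurable borel" and nn: "\<forall>y. 0 \<le> h y"
      and int: "(\<integral>\<^sup>+ y. ennreal (h y powr q) \<partial>lborel) \<le> 1" and l: "0 < l"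
    define V where "V x = ennreal l * havin_mazya_potential \<alpha> p h x" for x
    \<comment> \<open>The rescaling for which \<open>(l * C1 * a powr e) powr s\<close> equals
      \<open>B * a powr \<tau>\<close>.\<close>
    define B where "B = (l * C1) powr s"
    have B: "B > 0" unfolding B_def using l C1 by simp
    define \<Phi> where "\<Phi> = (\<lambda>y. h y powr r)"
    have lev: "{x \<in> UNIV. ennreal t < V x ennpowr s} \<subseteq> {x. ennreal ((t / B) powr (1 / \<tau>)) < frac_max (\<kappa> * r) \<Phi> x}"
      if t: "t > 0" for t
    proof (intro subsetI CollectI, rule ccontr)
      fix x assume x: "x \<in> {x \<in> UNIV. ennreal t < V x ennpowr s}"
      define a where "a = (t / B) powr (1 / \<tau>)"
      assume "\<not> ennreal ((t / B) powr (1 / \<tau>)) < frac_max (\<kappa> * r) \<Phi> x"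
      then have G: "frac_max (\<kappa> * r) (\<lambda>y. h y powr r) x \<le> ennreal a" by (simp add: a_def \<Phi>_def not_less)
      have a: "a > 0" unfolding a_def using t B by simp
      have "havin_mazya_potential \<alpha> p h x \<le> ennreal (C1 * a powr e)"
        unfolding e_def using C1_le h nn int a G by blast
      then have "V x \<le> ennreal l * ennreal (C1 * a powr e)" unfolding V_def by (rule mult_left_mono) simp
      also have "\<dots> = ennreal (l * C1 * a powr e)" using l C1 by (simp add: ennreal_mult[symmetric] mult.assoc)
      finally have "V x ennpowr s \<le> ennreal (l * C1 * a powr e) ennpowr s"
        by (rule ennpowr_mono) (rule spos)
      also have "\<dots> = ennreal (B * a powr \<tau>)"
        unfolding B_def using l C1 by (simp add: ennpowr_ennreal powr_mult powr_powr es)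
      also have "B * a powr \<tau> = t" unfolding a_def using t B \<tau>(1) by (simp add: powr_powr)
      finally show False using x by simp
    qed
    have "choquet_integral (?n - \<kappa> * q) UNIV (\<lambda>x. V x ennpowr s)
      \<le> (\<integral>\<^sup>+ t\<in>{0<..}. hausdorff_content (?n - \<kappa> * q) {x. ennreal ((t / B) powr (1 / \<tau>)) < frac_max (\<kappa> * r) \<Phi> x} \<partial>lborel)"
      unfolding choquet_integral_def
    proof (intro nn_integral_mono)
      fix t :: real
      show "hausdorff_content (?n - \<kappa> * q) {x \<in> UNIV. ennreal t < V x ennpowr s} * indicator {0<..} t
        \<le> hausdorff_content (?n - \<kappa> * q) {x. ennreal ((t / B) powr (1 / \<tau>)) < frac_max (\<kappa> * r) \<Phi> x} * indicator {0<..} t"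
        using hausdorff_content_mono[OF lev[of t]] by (cases "t > 0") auto
    qed
    also have "\<dots> \<le> ennreal (C2 * B)"
    proof -
      have "\<Phi> \<in> borel_measurable borel" "\<forall>y. 0 \<le> \<Phi> y" unfolding \<Phi>_def by simp_all
      moreover have "(\<integral>\<^sup>+ y. ennreal (\<Phi> y powr \<tau>) \<partial>lborel) \<le> 1"
        using int unfolding \<Phi>_def by (simp add: powr_powr \<tau>)
      ultimately show ?thesis using C2_le B by blast
    qed
    finally have "choquet_norm (?n - \<kappa> * q) UNIV s V \<le> ennreal (C2 * B) ennpowr (1 / s)"
      unfolding choquet_norm_def by (rule ennpowr_mono) (use spos in simp)
    also have "\<dots> = ennreal (C2 powr (1 / s) * C1 * l)"
      unfolding B_def using C1 C2 l spos by (simp add: ennpowr_ennreal powr_mult powr_powr mult_ac)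
    finally show "choquet_norm (?n - \<kappa> * q) UNIV s (\<lambda>x. ennreal l * havin_mazya_potential \<alpha> p h x)
      \<le> ennreal (C2 powr (1 / s) * C1 * l)" unfolding V_def .
  qed
qed

theorem theorem4p1:
  fixes n :: nat and \<alpha> \<kappa> p q s :: real
  assumes "n = CARD('n::finite)" and "n \<ge> 2"
    and "0 < \<alpha>" and "\<alpha> < real n"
    and "0 \<le> \<kappa>" and "\<kappa> < \<alpha>"
    and "q > 1" and "p > 1"
    and "p > 1 + 1 / q - \<alpha> / real n"
    and "\<alpha> * p * q < real n"
    and "s = q * (p - 1) * (real n - \<kappa> * q) / (real n - \<alpha> * p * q)"
  shows "\<exists>c::real. c \<ge> 0 \<and>
    (\<forall>f :: real ^ 'n \<Rightarrow> real. f \<in> Lebesgue_space q \<longrightarrow>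
      choquet_norm (real n - \<kappa> * q) UNIV s (havin_mazya_potential \<alpha> p f)
        \<le> ennreal (c * Lebesgue_norm q f powr (1 / (p - 1))))"
proof -
  have n: "n = DIM(real ^ 'n)" using assms(1) by simp
  obtain C where C: "C > 0" and C_le: "\<forall>(h :: real ^ 'n \<Rightarrow> real) l. h \<in> borel_measurable borel \<longrightarrow> (\<forall>y. 0 \<le> h y) \<longrightarrow>
    (\<integral>\<^sup>+ y. ennreal (h y powr q) \<partial>lborel) \<le> 1 \<longrightarrow> 0 < l \<longrightarrow>
    choquet_norm (real n - \<kappa> * q) UNIV s (\<lambda>x. ennreal l * havin_mazya_potential \<alpha> p h x) \<le> ennreal (C * l)"
    using choquet_norm_havin_mazya_potential_unit_le[where 'a = "real ^ 'n", of \<alpha> \<kappa> q p s] assms(3-) unfolding n by blast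
  show ?thesis
  proof (intro exI[of _ C] conjI allI impI)
    show "C \<ge> 0" using C by simp
    fix f :: "real ^ 'n \<Rightarrow> real" assume f: "f \<in> Lebesgue_space q"
    then have fm: "f \<in> borel_measurable (completion lborel)" and fi: "integrable lebesgue (\<lambda>x. \<bar>f x\<bar> powr q)"
      by (simp_all add: Lebesgue_space_def)
    \<comment> \<open>The estimates concern Borel functions. Neither the norm nor the potential
      changes when \<open>f\<close> is replaced by a Borel representative.\<close>
    obtain g where g[measurable]: "g \<in> borel_measurable borel" and fg: "AE x in lborel. f x = g x"
      using completion_ex_borel_measurable_real[OF fm] by auto
    define N where "N = Lebesgue_norm q f"
    define I where "I = (LINT x|lebesgue. \<bar>f x\<bar> powr q)"
    have I: "I \<ge> 0" unfolding I_def by simp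
    have NI: "N powr q = I" unfolding N_def Lebesgue_norm_def I_def[symmetric] using I assms(7) by (simp add: powr_powr)
    have N: "N \<ge> 0" unfolding N_def Lebesgue_norm_def by simp
    have gI: "(\<integral>\<^sup>+ x. ennreal (\<bar>g x\<bar> powr q) \<partial>lborel) = ennreal I"
    proof -
      have "(\<integral>\<^sup>+ x. ennreal (\<bar>g x\<bar> powr q) \<partial>lborel) = (\<integral>\<^sup>+ x. ennreal (\<bar>f x\<bar> powr q) \<partial>lborel)"
        by (rule nn_integral_cong_AE) (use fg in eventually_elim, simp)
      also have "\<dots> = (\<integral>\<^sup>+ x. ennreal (\<bar>f x\<bar> powr q) \<partial>lebesgue)" by (simp add: nn_integral_completion)
      also have "\<dots> = ennreal I" unfolding I_def by (rule nn_integral_eq_integral[OF fi]) simp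
      finally show ?thesis .
    qed
    \<comment> \<open>The function is normalised by an arbitrary positive \<open>l\<close> with
      \<open>N \<le> l\<close> instead of \<open>N\<close>; \<open>le_ennpowrI\<close> then covers
      \<open>N = 0\<close> by letting \<open>l\<close> tend to zero.\<close>
    have "choquet_norm (real n - \<kappa> * q) UNIV s (havin_mazya_potential \<alpha> p f)
      \<le> ennreal C * ennreal N ennpowr (1 / (p - 1))"
    proof (rule le_ennpowrI)
      fix l :: real assume l: "0 < l" and "ennreal N \<le> ennreal l"
      then have Nl: "N \<le> l" by simp
      define h where "h x = \<bar>g x\<bar> / l" for x
      have h[measurable]: "h \<in> borel_measurable borel" unfolding h_def[abs_def] by measurable
      have "(\<integral>\<^sup>+ x. ennreal (h x powr q) \<partial>lborel) = (\<integral>\<^sup>+ x. ennreal (l powr (-q)) * ennreal (\<bar>g x\<bar> powr q) \<partial>lborel)"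
        unfolding h_def using l
        by (intro nn_integral_cong) (simp add: ennreal_mult[symmetric] powr_divide powr_minus field_simps)
      also have "\<dots> = ennreal (l powr (-q) * I)" using I by (simp add: nn_integral_cmult gI ennreal_mult)
      also have "\<dots> \<le> 1"
      proof -
        have "I \<le> l powr q" unfolding NI[symmetric] using N Nl assms(7) by (intro powr_mono2) auto
        then have "l powr (-q) * I \<le> l powr (-q) * l powr q" by (rule mult_left_mono) simp
        then show ?thesis using l by (simp add: powr_add[symmetric])
      qed
      finally have int: "(\<integral>\<^sup>+ x. ennreal (h x powr q) \<partial>lborel) \<le> 1" .
      have "havin_mazya_potential \<alpha> p f = havin_mazya_potential \<alpha> p g"
        by (rule havin_mazya_potential_cong_AE[OF fg])
      also have "\<dots> = havin_mazya_potential \<alpha> p (\<lambda>y. l * h y)"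
        unfolding havin_mazya_potential_def h_def using l by simp
      also have "\<dots> = (\<lambda>x. ennreal (l powr (1 / (p - 1))) * havin_mazya_potential \<alpha> p h x)"
        using l assms(8) by (intro ext havin_mazya_potential_scale h)
      finally have "havin_mazya_potential \<alpha> p f = (\<lambda>x. ennreal (l powr (1 / (p - 1))) * havin_mazya_potential \<alpha> p h x)" .
      then show "choquet_norm (real n - \<kappa> * q) UNIV s (havin_mazya_potential \<alpha> p f) \<le> ennreal (C * l powr (1 / (p - 1)))"
        using C_le h int l by (simp add: h_def)
    qed (use assms(8) C in auto)
    also have "\<dots> = ennreal (C * N powr (1 / (p - 1)))"
      using C N by (simp add: ennpowr_ennreal ennreal_mult)
    finally show "choquet_norm (real n - \<kappa> * q) UNIV s (havin_mazya_potential \<alpha> p f)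
        \<le> ennreal (C * Lebesgue_norm q f powr (1 / (p - 1)))" unfolding N_def .
  qed
qed

end
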